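(* Let $\mathbf w$ be a rational weight system with $w^{(i)}_0<\cdots<w^{(i)}_{s_i}$ for each $i$. Let $(\rho,\mathbf P)\in\mathfrak{PRP}(r,\mathbf d)$ and $x=(x_a)_{a\in Q_1}\in\varphi^{-1}(\rho,\mathbf P)$. Then $(\rho,\mathbf P)$ is semistable with respect to $\mathbf w$ if and only if $x$ is semistable with respect to $\overrightarrow{w_Q}$. In particular, $$\varphi^{-1}(\mathfrak{PRP}^{\mathbf w\text{-}\mathrm{ss}}(r,\mathbf d))=\mathfrak{REP}^{\overrightarrow{w_Q}\text{-}\mathrm{ss}}_{\mathrm{prp}}(Q,\overrightarrow{d_Q}):=\mathfrak{REP}_{\mathrm{prp}}(Q,\overrightarrow{d_Q})\cap\mathfrak{REP}^{\overrightarrow{w_Q}\text{-}\mathrm{ss}}(Q,\overrightarrow{d_Q}).$$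
   Context: Setup. $\Gamma$ is the group with generators $\alpha_j,\beta_j$ ($1\le j\le g$), $\gamma_i$ ($1\le i\le n$), $n\ge1$, and single relation $[\alpha_1,\beta_1]\cdots[\alpha_g,\beta_g]\gamma_1\cdots\gamma_n=1$ (the fundamental group of a genus $g$ surface with $n$ punctures, of negative Euler characteristic). $V=\mathbb C^r$, $G=\mathrm{GL}(V)$. Parabolic representation pairs. Let $\mathbf d=\{(d^{(i)}_0,\dots,d^{(i)}_{s_i})\}_{i}$ be positive integers with $\sum_\ell d^{(i)}_\ell=r$. $\mathfrak{PRP}(r,\mathbf d)$ is the variety of pairs $(\rho,\mathbf P=(P_{\mathcal F^{(i)}})_{i=1}^n)$ with $\rho:\Gamma\to G$ a homomorphism, $P_{\mathcal F^{(i)}}\subset G$ the stabilizer of a flag $V=V^{(i)}_0\supsetneq\cdots\supsetneq V^{(i)}_{s_i}\supsetneq V^{(i)}_{s_i+1}=0$ with $\dim V^{(i)}_\ell/V^{(i)}_{\ell+1}=d^{(i)}_\ell$, and $\rho(\gamma_i)\in P_{\mathcal F^{(i)}}$. Stability of pairs. A weight system is $\mathbf w=\{(w^{(i)}_0,\dots,w^{(i)}_{s_i})\}_i$. $\deg((\rho,\mathbf P),\mathbf w)=\sum_i\sum_\ell d^{(i)}_\ell w^{(i)}_\ell$, slope $=\deg/r$. A subrepresentation on $V'\subset V$ carries the induced flags and weights (weight of an induced subspace $V'_{\ell'}$ is $w^{(i)}_m$ with $m$ maximal such that $V^{(i)}_m\cap V'=V'_{\ell'}$), so its degree is $\sum_i\sum_\ell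 w^{(i)}_\ell\dim\big((V^{(i)}_\ell\cap V')/(V^{(i)}_{\ell+1}\cap V')\big)$ and its slope is this divided by $\dim V'$. The pair is semistable if every proper nonzero subrepresentation has slope $\le$ the slope of the pair. $\mathfrak{PRP}^{\mathbf w\text{-}\mathrm{ss}}(r,\mathbf d)$ is the set of semistable pairs with respect to $\mathbf w$. Quiver. $Q=(Q_0,Q_1,s,t)$ has vertices $u$ and $u^{(i)}_\ell$ ($1\le\ell\le s_i$, $1\le i\le n$; put $u^{(i)}_0=u$) and arrows: loops $a_j,b_j$ ($1\le j\le g$), $c^{(i)}$ ($1\le i\le n$) at $u$; arrows $e^{(i)}_\ell:u^{(i)}_\ell\to u^{(i)}_{\ell-1}$; loops $c^{(i)}_\ell$ at $u^{(i)}_\ell$ (put $c^{(i)}_0=c^{(i)}$). Dimension vector $\overrightarrow{d_Q}$: $d_u=r$, $d_{u^{(i)}_\ell}=\sum_{m\ge\ell}d^{(i)}_m$. $\mathfrak{REP}(Q,\overrightarrow{d_Q})=\bigoplus_{a\in Q_1}\mathrm{Hom}(\mathbb C^{d_{s(a)}},\mathbb C^{d_{t(a)}})$. $\mathfrak{REP}_{\mathrm{prp}}(Q,\overrightarrow{d_Q})$ is the subset of $(x_a)$ with all $x_a$ injective, $x_{c^{(i)}_{\ell-1}}x_{e^{(i)}_\ell}=x_{e^{(i)}_\ell}x_{c^{(i)}_\ell}$ for all $1\le\ell\le s_i$ and all $i$, and $[x_{a_1},x_{b_1}]\cdots[x_{a_g},x_{b_g}]x_{c^{(1)}}\cdots x_{c^{(n)}}=\mathrm{Id}$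 (group commutators). The map $\varphi:\mathfrak{REP}_{\mathrm{prp}}(Q,\overrightarrow{d_Q})\to\mathfrak{PRP}(r,\mathbf d)$ sends $(x_a)$ to $(\rho,\mathbf P)$ with $\rho(\alpha_j)=x_{a_j}$, $\rho(\beta_j)=x_{b_j}$, $\rho(\gamma_i)=x_{c^{(i)}}$, and $V^{(i)}_\ell$ the image of $x_{e^{(i)}_1}\circ\cdots\circ x_{e^{(i)}_\ell}$ in $V$. Quiver weights $\overrightarrow{w_Q}=(w_v)_{v\in Q_0}$: $w_u=-\frac1r\sum_i\sum_{\ell=0}^{s_i}w^{(i)}_\ell d^{(i)}_\ell+\sum_iw^{(i)}_0$ and $w_{u^{(i)}_\ell}=w^{(i)}_\ell-w^{(i)}_{\ell-1}$. A representation $x\in\mathfrak{REP}(Q,\overrightarrow{d_Q})$ is semistable with respect to $\overrightarrow{w_Q}$ if $\sum_vw_vd'_v\le0$ for the dimension vector $(d'_v)$ of every proper subrepresentation; $\mathfrak{REP}^{\overrightarrow{w_Q}\text{-}\mathrm{ss}}(Q,\overrightarrow{d_Q})$ is the set of these. *)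

theory Defs
  imports
    "Jordan_Normal_Form.VS_Connect"
    "Graph_Theory.Digraph"
begin

section \<open>Groups given by generators and relators\<close>

text \<open>The letter \<open>(x, True)\<close> stands for the generator \<open>x\<close>, and \<open>(x, False)\<close> for its formal
  inverse.\<close>

type_synonym 'a word = "('a \<times> bool) list"

text \<open>The least congruence on the words over \<open>S\<close> that cancels adjacent inverse letters and
  makes the relators in \<open>R\<close> trivial.\<close>

inductive_set word_cong :: "'a set \<Rightarrow> 'a word set \<Rightarrow> ('a word \<times> 'a word) set"
  for S :: "'a set" and R :: "'a word set" where
  refl: "u \<in> lists (S \<times> UNIV) \<Longrightarrow> (u, u) \<in> word_cong S R"
| sym: "(u, v) \<in> word_cong S R \<Longrightarrow> (v, u) \<in> word_cong S R"
| trans: "(u, v) \<in> word_cong S R \<Longrightarrow> (v, w) \<in> word_cong S R \<Longrightarrow> (u, w) \<in> word_cong S R"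
| cancel: "u \<in> lists (S \<times> UNIV) \<Longrightarrow> v \<in> lists (S \<times> UNIV) \<Longrightarrow> x \<in> S \<Longrightarrow>
    (u @ [(x, b), (x, \<not> b)] @ v, u @ v) \<in> word_cong S R"
| relator: "u \<in> lists (S \<times> UNIV) \<Longrightarrow> v \<in> lists (S \<times> UNIV) \<Longrightarrow>
    z \<in> R \<Longrightarrow> z \<in> lists (S \<times> UNIV) \<Longrightarrow> (u @ z @ v, u @ v) \<in> word_cong S R"

definition presented_group :: "'a set \<Rightarrow> 'a word set \<Rightarrow> 'a word set monoid" where
  "presented_group S R =
    \<lparr>carrier = lists (S \<times> UNIV) // word_cong S R,
     mult = (\<lambda>A B. \<Union>u\<in>A. \<Union>v\<in>B. word_cong S R `` {u @ v}),
     one = word_cong S R `` {[]}\<rparr>"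

definition pres_gen :: "'a set \<Rightarrow> 'a word set \<Rightarrow> 'a \<Rightarrow> 'a word set" where
  "pres_gen S R x = word_cong S R `` {[(x, True)]}"

lemma word_cong_words:
  assumes "(u, v) \<in> word_cong S R"
  shows "u \<in> lists (S \<times> UNIV) \<and> v \<in> lists (S \<times> UNIV)"
  using assms by induction auto

lemma equiv_word_cong: "equiv (lists (S \<times> UNIV)) (word_cong S R)"
proof (rule equivI)
  show "word_cong S R \<subseteq> lists (S \<times> UNIV) \<times> lists (S \<times> UNIV)"
    by (rule subrelI) (blast dest: word_cong_words)
  show "refl_on (lists (S \<times> UNIV)) (word_cong S R)"
    using word_cong.refl unfolding refl_on_def by blast
  show "sym_on UNIV (word_cong S R)"
    by (auto intro: symI word_cong.sym)
  show "trans_on UNIV (word_cong S R)"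
    by (auto intro: transI word_cong.trans)
qed

lemma word_cong_append:
  assumes "(u, v) \<in> word_cong S R" "p \<in> lists (S \<times> UNIV)" "q \<in> lists (S \<times> UNIV)"
  shows "(p @ u @ q, p @ v @ q) \<in> word_cong S R"
  using assms(1)
proof induction
  case (refl u)
  then show ?case using assms(2,3) by (intro word_cong.refl) auto
next
  case (sym u v)
  then show ?case by (blast intro: word_cong.sym)
next
  case (trans u v w)
  then show ?case by (blast intro: word_cong.trans)
next
  case (cancel u v x b)
  then show ?case
    using assms(2,3) word_cong.cancel[of "p @ u" S "v @ q" x b R] by simp
next
  case (relator u v z)
  then show ?case
    using assms(2,3) word_cong.relator[of "p @ u" S "v @ q" z R] by simp
qed

lemma word_cong_mult:
  assumes "(u, u') \<in> word_cong S R" "(v, v') \<in> word_cong S R"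
  shows "(u @ v, u' @ v') \<in> word_cong S R"
proof -
  have "(u @ v, u' @ v) \<in> word_cong S R"
    using word_cong_append[OF assms(1), of "[]" v] word_cong_words[OF assms(2)] by simp
  moreover have "(u' @ v, u' @ v') \<in> word_cong S R"
    using word_cong_append[OF assms(2), of u' "[]"] word_cong_words[OF assms(1)] by simp
  ultimately show ?thesis by (rule word_cong.trans)
qed

lemma carrier_presented_groupE:
  assumes "A \<in> carrier (presented_group S R)"
  obtains u where "u \<in> lists (S \<times> UNIV)" "A = word_cong S R `` {u}"
  using assms by (auto simp: presented_group_def elim!: quotientE)

lemma class_in_presented_group:
  "u \<in> lists (S \<times> UNIV) \<Longrightarrow> word_cong S R `` {u} \<in> carrier (presented_group S R)"
  by (auto simp: presented_group_def intro: quotientI)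

lemma word_class_eq_iff:
  assumes "u \<in> lists (S \<times> UNIV)" "v \<in> lists (S \<times> UNIV)"
  shows "word_cong S R `` {u} = word_cong S R `` {v} \<longleftrightarrow> (u, v) \<in> word_cong S R"
  using eq_equiv_class_iff[OF equiv_word_cong assms] .

lemma presented_group_mult:
  assumes "u \<in> lists (S \<times> UNIV)" "v \<in> lists (S \<times> UNIV)"
  shows "word_cong S R `` {u} \<otimes>\<^bsub>presented_group S R\<^esub> word_cong S R `` {v} = word_cong S R `` {u @ v}"
proof -
  let ?C = "word_cong S R"
  have eq: "?C `` {u' @ v'} = ?C `` {u @ v}" if "u' \<in> ?C `` {u}" "v' \<in> ?C `` {v}" for u' v'
  proof -
    have "(u, u') \<in> ?C" "(v, v') \<in> ?C" using that by blast+
    then show ?thesis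
      by (intro equiv_class_eq[OF equiv_word_cong] word_cong.sym[OF word_cong_mult])
  qed
  have ne: "u \<in> ?C `` {u}" "v \<in> ?C `` {v}"
    using assms by (blast intro: word_cong.refl)+
  have "(\<Union>u'\<in>?C `` {u}. \<Union>v'\<in>?C `` {v}. ?C `` {u' @ v'}) = ?C `` {u @ v}"
  proof (intro subset_antisym UN_least)
    show "?C `` {u' @ v'} \<subseteq> ?C `` {u @ v}" if "u' \<in> ?C `` {u}" "v' \<in> ?C `` {v}" for u' v'
      using eq[OF that] by (rule equalityD1)
    show "?C `` {u @ v} \<subseteq> (\<Union>u'\<in>?C `` {u}. \<Union>v'\<in>?C `` {v}. ?C `` {u' @ v'})"
      using ne by blast
  qed
  then show ?thesis by (simp only: presented_group_def monoid.simps partial_object.simps)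
qed

lemma presented_group_one: "\<one>\<^bsub>presented_group S R\<^esub> = word_cong S R `` {[]}"
  by (simp add: presented_group_def)

lemma word_inverse:
  assumes "u \<in> lists (S \<times> UNIV)"
  shows "\<exists>v\<in>lists (S \<times> UNIV). (v @ u, []) \<in> word_cong S R"
  using assms
proof (induction u)
  case Nil
  then show ?case by (auto intro!: bexI[of _ "[]"] word_cong.refl)
next
  case (Cons y u)
  then obtain v where v: "v \<in> lists (S \<times> UNIV)" "(v @ u, []) \<in> word_cong S R" by auto
  obtain x b where y: "y = (x, b)" "x \<in> S" using Cons by (cases y) auto
  have "(v @ [(x, \<not> b), (x, \<not> \<not> b)] @ u, v @ u) \<in> word_cong S R"
    using Cons v y by (intro word_cong.cancel) auto
  then have "((v @ [(x, \<not> b)]) @ y # u, []) \<in> word_cong S R"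
    using word_cong.trans[OF _ v(2)] y by simp
  then show ?case using v y by (intro bexI[of _ "v @ [(x, \<not> b)]"]) auto
qed

lemma group_presented_group: "group (presented_group S R)"
proof (rule groupI)
  show "\<one>\<^bsub>presented_group S R\<^esub> \<in> carrier (presented_group S R)"
    unfolding presented_group_one by (rule class_in_presented_group) simp
next
  fix A B assume A: "A \<in> carrier (presented_group S R)" and B: "B \<in> carrier (presented_group S R)"
  from A B show "A \<otimes>\<^bsub>presented_group S R\<^esub> B \<in> carrier (presented_group S R)"
    by (elim carrier_presented_groupE) (simp add: presented_group_mult class_in_presented_group)
  fix C assume C: "C \<in> carrier (presented_group S R)"
  with A B show "A \<otimes>\<^bsub>presented_group S R\<^esub> B \<otimes>\<^bsub>presented_group S R\<^esub> C
      = A \<otimes>\<^bsub>presented_group S R\<^esub> (B \<otimes>\<^bsub>presented_group S R\<^esub> C)"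
    by (elim carrier_presented_groupE) (simp add: presented_group_mult)
next
  fix A assume A: "A \<in> carrier (presented_group S R)"
  then show "\<one>\<^bsub>presented_group S R\<^esub> \<otimes>\<^bsub>presented_group S R\<^esub> A = A"
    by (elim carrier_presented_groupE) (simp add: presented_group_mult presented_group_one)
  from A obtain u where u: "u \<in> lists (S \<times> UNIV)" "A = word_cong S R `` {u}"
    by (rule carrier_presented_groupE)
  from word_inverse[OF u(1)] obtain v
    where v: "v \<in> lists (S \<times> UNIV)" "(v @ u, []) \<in> word_cong S R" by blast
  have "word_cong S R `` {v} \<otimes>\<^bsub>presented_group S R\<^esub> A = \<one>\<^bsub>presented_group S R\<^esub>"
    using u v by (simp add: presented_group_mult presented_group_one word_class_eq_iff)
  with v show "\<exists>B\<in>carrier (presented_group S R). B \<otimes>\<^bsub>presented_group S R\<^esub> A = \<one>\<^bsub>presented_group S R\<^esub>"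
    by (blast intro: class_in_presented_group)
qed

lemma pres_gen_closed: "x \<in> S \<Longrightarrow> pres_gen S R x \<in> carrier (presented_group S R)"
  unfolding pres_gen_def by (rule class_in_presented_group) simp

fun letter_val :: "('b, 'c) monoid_scheme \<Rightarrow> ('a \<Rightarrow> 'b) \<Rightarrow> 'a \<times> bool \<Rightarrow> 'b" where
  "letter_val G f (x, b) = (if b then f x else inv\<^bsub>G\<^esub> (f x))"

definition grp_list_prod :: "('a, 'b) monoid_scheme \<Rightarrow> 'a list \<Rightarrow> 'a" where
  "grp_list_prod G xs = foldr (\<otimes>\<^bsub>G\<^esub>) xs \<one>\<^bsub>G\<^esub>"

lemma grp_list_prod_simps [simp]:
  "grp_list_prod G [] = \<one>\<^bsub>G\<^esub>"
  "grp_list_prod G (a # xs) = a \<otimes>\<^bsub>G\<^esub> grp_list_prod G xs"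
  by (simp_all add: grp_list_prod_def)

lemma (in group) grp_list_prod_closed:
  "set xs \<subseteq> carrier G \<Longrightarrow> grp_list_prod G xs \<in> carrier G"
  by (induction xs) auto

lemma (in group) grp_list_prod_append:
  "set xs \<subseteq> carrier G \<Longrightarrow> set ys \<subseteq> carrier G \<Longrightarrow>
    grp_list_prod G (xs @ ys) = grp_list_prod G xs \<otimes> grp_list_prod G ys"
  by (induction xs) (auto simp: grp_list_prod_closed m_assoc)

definition word_val :: "('b, 'c) monoid_scheme \<Rightarrow> ('a \<Rightarrow> 'b) \<Rightarrow> 'a word \<Rightarrow> 'b" where
  "word_val G f u = grp_list_prod G (map (letter_val G f) u)"

lemma (in group) letter_val_closed:
  "f \<in> S \<rightarrow> carrier G \<Longrightarrow> y \<in> S \<times> UNIV \<Longrightarrow> letter_val G f y \<in> carrier G"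
  by (cases y) auto

lemma (in group) letter_vals_closed:
  assumes "f \<in> S \<rightarrow> carrier G" "u \<in> lists (S \<times> UNIV)"
  shows "set (map (letter_val G f) u) \<subseteq> carrier G"
proof
  fix a assume "a \<in> set (map (letter_val G f) u)"
  then obtain y where "y \<in> set u" "a = letter_val G f y" by auto
  moreover from this have "y \<in> S \<times> UNIV" using assms(2) by (simp only: in_lists_conv_set)
  ultimately show "a \<in> carrier G" using letter_val_closed[OF assms(1)] by simp
qed

lemma (in group) word_val_closed:
  "f \<in> S \<rightarrow> carrier G \<Longrightarrow> u \<in> lists (S \<times> UNIV) \<Longrightarrow> word_val G f u \<in> carrier G"
  unfolding word_val_def
  by (rule grp_list_prod_closed[OF letter_vals_closed])

lemma (in group) word_val_append:
  assumes "f \<in> S \<rightarrow> carrier G" "u \<in> lists (S \<times> UNIV)" "v \<in> lists (S \<times> UNIV)"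
  shows "word_val G f (u @ v) = word_val G f u \<otimes> word_val G f v"
  unfolding word_val_def map_append
  by (rule grp_list_prod_append; rule letter_vals_closed; fact assms)

lemma (in group) word_val_cong:
  assumes f: "f \<in> S \<rightarrow> carrier G" and R: "\<And>z. z \<in> R \<Longrightarrow> word_val G f z = \<one>"
    and uv: "(u, v) \<in> word_cong S R"
  shows "word_val G f u = word_val G f v"
  using uv
proof induction
  case (cancel u v x b)
  have x: "f x \<in> carrier G" using f cancel by auto
  have "word_val G f [(x, b), (x, \<not> b)] = \<one>"
    using x by (auto simp: word_val_def)
  moreover have "[(x, b), (x, \<not> b)] \<in> lists (S \<times> UNIV)" using cancel by auto
  moreover have "[(x, b), (x, \<not> b)] @ v \<in> lists (S \<times> UNIV)" using cancel by auto
  ultimately show ?case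
    using cancel by (simp only: word_val_append[OF f] word_val_closed[OF f] l_one)
next
  case (relator u v z)
  have "z @ v \<in> lists (S \<times> UNIV)" using relator by auto
  then show ?case
    using relator R by (simp only: word_val_append[OF f] word_val_closed[OF f] l_one)
qed auto

lemma (in group) ex1_hom_presented_group:
  assumes f: "f \<in> S \<rightarrow> carrier G" and R: "\<And>z. z \<in> R \<Longrightarrow> word_val G f z = \<one>"
  shows "\<exists>!h. h \<in> hom (presented_group S R) G \<and> h \<in> extensional (carrier (presented_group S R)) \<and>
    (\<forall>x\<in>S. h (pres_gen S R x) = f x)"
proof -
  let ?H = "presented_group S R"
  interpret H: group ?H by (rule group_presented_group)
  define h where "h = (\<lambda>A\<in>carrier ?H. word_val G f (SOME u. u \<in> A))"
  have h_class: "h (word_cong S R `` {u}) = word_val G f u" if u: "u \<in> lists (S \<times> UNIV)" for u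
  proof -
    have "(SOME v. v \<in> word_cong S R `` {u}) \<in> word_cong S R `` {u}"
      by (rule someI[of _ u]) (use u in \<open>auto intro: word_cong.refl\<close>)
    then show ?thesis
      using word_val_cong[OF f R] class_in_presented_group[OF u] by (auto simp: h_def)
  qed
  have hom: "h \<in> hom ?H G"
  proof (rule homI)
    fix A assume A: "A \<in> carrier ?H"
    then show "h A \<in> carrier G"
      by (elim carrier_presented_groupE) (simp add: h_class word_val_closed[OF f])
    fix B assume B: "B \<in> carrier ?H"
    obtain u v where "u \<in> lists (S \<times> UNIV)" "A = word_cong S R `` {u}"
      "v \<in> lists (S \<times> UNIV)" "B = word_cong S R `` {v}"
      using A B by (elim carrier_presented_groupE) blast
    then show "h (A \<otimes>\<^bsub>?H\<^esub> B) = h A \<otimes> h B"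
      using h_class[of "u @ v"] by (simp add: presented_group_mult h_class word_val_append[OF f])
  qed
  have gen: "h (pres_gen S R x) = f x" if "x \<in> S" for x
  proof -
    have "f x \<in> carrier G" using f that by auto
    then show ?thesis
      unfolding pres_gen_def using that by (subst h_class) (auto simp: word_val_def)
  qed
  show ?thesis
  proof (rule ex1I[of _ h])
    show "h \<in> hom ?H G \<and> h \<in> extensional (carrier ?H) \<and> (\<forall>x\<in>S. h (pres_gen S R x) = f x)"
      using hom gen by (auto simp: h_def)
  next
    fix k assume k: "k \<in> hom ?H G \<and> k \<in> extensional (carrier ?H) \<and> (\<forall>x\<in>S. k (pres_gen S R x) = f x)"
    then interpret k: group_hom ?H G k by unfold_locales auto
    have letter: "k (word_cong S R `` {[(x, b)]}) = letter_val G f (x, b)" if x: "x \<in> S" for x b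
    proof (cases b)
      case True
      then show ?thesis using k x by (auto simp: pres_gen_def)
    next
      case False
      have "([] @ [(x, False), (x, \<not> False)] @ [], [] @ []) \<in> word_cong S R"
        using x by (intro word_cong.cancel) auto
      then have "word_cong S R `` {[(x, False)]} \<otimes>\<^bsub>?H\<^esub> pres_gen S R x = \<one>\<^bsub>?H\<^esub>"
        using x by (simp add: pres_gen_def presented_group_mult presented_group_one word_class_eq_iff)
      then have "word_cong S R `` {[(x, False)]} = inv\<^bsub>?H\<^esub> (pres_gen S R x)"
        using x by (intro H.inv_equality[symmetric])
          (auto simp: pres_gen_closed intro: class_in_presented_group)
      then show ?thesis using k x False by (simp add: pres_gen_closed)
    qed
    have word: "k (word_cong S R `` {u}) = word_val G f u" if "u \<in> lists (S \<times> UNIV)" for u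
      using that
    proof (induction u)
      case Nil
      then show ?case using k.hom_one by (simp add: presented_group_one word_val_def)
    next
      case (Cons y u)
      obtain x b where y: "y = (x, b)" "x \<in> S" using Cons by (cases y) auto
      have yw: "[y] \<in> lists (S \<times> UNIV)" using y by auto
      have "word_cong S R `` {y # u} = word_cong S R `` {[y]} \<otimes>\<^bsub>?H\<^esub> word_cong S R `` {u}"
        using presented_group_mult[OF yw, of u R] Cons by simp
      then have "k (word_cong S R `` {y # u}) = k (word_cong S R `` {[y]}) \<otimes> k (word_cong S R `` {u})"
        using Cons yw by (simp del: letter_val.simps add: class_in_presented_group)
      then show ?case using Cons y letter[of x b] by (simp add: word_val_def)
    qed
    show "k = h"
    proof (rule extensionalityI[of _ "carrier ?H"])
      show "k \<in> extensional (carrier ?H)" "h \<in> extensional (carrier ?H)"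
        using k by (auto simp: h_def)
      fix A assume "A \<in> carrier ?H"
      then show "k A = h A" by (elim carrier_presented_groupE) (simp add: word h_class)
    qed
  qed
qed


section \<open>The fundamental group of a punctured surface\<close>

datatype surf_gen = Alpha nat | Beta nat | Gamma nat

definition surf_gens :: "nat \<Rightarrow> nat \<Rightarrow> surf_gen set" where
  "surf_gens g n = Alpha ` {1..g} \<union> Beta ` {1..g} \<union> Gamma ` {1..n}"

definition surf_relator :: "nat \<Rightarrow> nat \<Rightarrow> surf_gen word" where
  "surf_relator g n =
    concat (map (\<lambda>j. [(Alpha j, True), (Beta j, True), (Alpha j, False), (Beta j, False)]) [1..<Suc g])
    @ map (\<lambda>i. (Gamma i, True)) [1..<Suc n]"

definition surf_group :: "nat \<Rightarrow> nat \<Rightarrow> surf_gen word set monoid" where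
  "surf_group g n = presented_group (surf_gens g n) {surf_relator g n}"

definition surf_elt :: "nat \<Rightarrow> nat \<Rightarrow> surf_gen \<Rightarrow> surf_gen word set" where
  "surf_elt g n x = pres_gen (surf_gens g n) {surf_relator g n} x"


section \<open>Linear algebra over the complex numbers\<close>

definition GL :: "nat \<Rightarrow> complex mat monoid" where
  "GL r = units_of (ring_mat TYPE(complex) r ())"

lemma group_GL: "group (GL r)"
proof -
  interpret ring "ring_mat TYPE(complex) r ()" by (rule ring_mat)
  show ?thesis unfolding GL_def by (rule units_group)
qed

lemma carrier_GL_if_inj:
  assumes A: "A \<in> carrier_mat r r" and inj: "inj_on (\<lambda>v. A *\<^sub>v v) (carrier_vec r)"
  shows "A \<in> carrier (GL r)"
proof -
  have "det A \<noteq> 0"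
  proof
    assume "det A = 0"
    then obtain v where v: "v \<in> carrier_vec r" "v \<noteq> 0\<^sub>v r" "A *\<^sub>v v = 0\<^sub>v r"
      using det_0_iff_vec_prod_zero[OF A] by auto
    moreover have "A *\<^sub>v 0\<^sub>v r = 0\<^sub>v r" using A by (intro eq_vecI) auto
    ultimately show False using inj_onD[OF inj, of v "0\<^sub>v r"] by simp
  qed
  then show ?thesis
    unfolding GL_def units_of_carrier by (rule det_non_zero_imp_unit[OF A])
qed

abbreviation lin_subspace :: "nat \<Rightarrow> complex vec set \<Rightarrow> bool" where
  "lin_subspace m W \<equiv> VectorSpace.subspace class_ring W (module_vec TYPE(complex) m)"

definition sdim :: "nat \<Rightarrow> complex vec set \<Rightarrow> nat" where
  "sdim m W = vectorspace.dim class_ring ((module_vec TYPE(complex) m)\<lparr>carrier := W\<rparr>)"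

text \<open>The dimension of the quotient \<open>A / B\<close> for subspaces \<open>B \<subseteq> A\<close> of \<open>\<complex>\<^sup>m\<close>.\<close>

definition quot_dim :: "nat \<Rightarrow> complex vec set \<Rightarrow> complex vec set \<Rightarrow> nat" where
  "quot_dim m A B = sdim m A - sdim m B"


section \<open>Parabolic representation pairs\<close>

text \<open>A flag \<open>F 0 \<supset> \<dots> \<supset> F s \<supset> F (s + 1) = 0\<close> in \<open>\<complex>\<^sup>r\<close> of type \<open>(d 0, \<dots>, d s)\<close>. The
  sequence is \<open>undefined\<close> beyond \<open>s + 1\<close>, so that a flag is a unique HOL object.\<close>

definition is_flag :: "nat \<Rightarrow> nat \<Rightarrow> (nat \<Rightarrow> nat) \<Rightarrow> (nat \<Rightarrow> complex vec set) \<Rightarrow> bool" where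
  "is_flag r s d F \<longleftrightarrow>
    F \<in> extensional {0..Suc s} \<and>
    (\<forall>l\<in>{0..Suc s}. lin_subspace r (F l)) \<and>
    F 0 = carrier_vec r \<and> F (Suc s) = {0\<^sub>v r} \<and>
    (\<forall>l\<in>{0..s}. F (Suc l) \<subset> F l \<and> quot_dim r (F l) (F (Suc l)) = d l)"

definition flag_stabilizer :: "nat \<Rightarrow> nat \<Rightarrow> (nat \<Rightarrow> complex vec set) \<Rightarrow> complex mat set" where
  "flag_stabilizer r s F = {A \<in> carrier (GL r). \<forall>l\<in>{0..Suc s}. (\<lambda>v. A *\<^sub>v v) ` F l = F l}"

text \<open>A parabolic subgroup determines the flag that it stabilizes.\<close>

definition flag_of :: "nat \<Rightarrow> nat \<Rightarrow> (nat \<Rightarrow> nat) \<Rightarrow> complex mat set \<Rightarrow> nat \<Rightarrow> complex vec set" where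
  "flag_of r s d P = (THE F. is_flag r s d F \<and> flag_stabilizer r s F = P)"

type_synonym prp_pair = "(surf_gen word set \<Rightarrow> complex mat) \<times> (nat \<Rightarrow> complex mat set)"

definition PRP :: "nat \<Rightarrow> nat \<Rightarrow> nat \<Rightarrow> (nat \<Rightarrow> nat) \<Rightarrow> (nat \<Rightarrow> nat \<Rightarrow> nat) \<Rightarrow> prp_pair set" where
  "PRP g n r s d =
    {(\<rho>, P). \<rho> \<in> hom (surf_group g n) (GL r) \<and> \<rho> \<in> extensional (carrier (surf_group g n)) \<and>
      P \<in> extensional {1..n} \<and>
      (\<forall>i\<in>{1..n}. (\<exists>F. is_flag r (s i) (d i) F \<and> P i = flag_stabilizer r (s i) F) \<and>
        \<rho> (surf_elt g n (Gamma i)) \<in> P i)}"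

definition pair_deg :: "nat \<Rightarrow> (nat \<Rightarrow> nat) \<Rightarrow> (nat \<Rightarrow> nat \<Rightarrow> nat) \<Rightarrow> (nat \<Rightarrow> nat \<Rightarrow> real) \<Rightarrow> real" where
  "pair_deg n s d w = (\<Sum>i=1..n. \<Sum>l=0..s i. real (d i l) * w i l)"

definition pair_slope ::
    "nat \<Rightarrow> nat \<Rightarrow> (nat \<Rightarrow> nat) \<Rightarrow> (nat \<Rightarrow> nat \<Rightarrow> nat) \<Rightarrow> (nat \<Rightarrow> nat \<Rightarrow> real) \<Rightarrow> real" where
  "pair_slope n r s d w = pair_deg n s d w / real r"

definition is_subrep ::
    "nat \<Rightarrow> nat \<Rightarrow> nat \<Rightarrow> (surf_gen word set \<Rightarrow> complex mat) \<Rightarrow> complex vec set \<Rightarrow> bool" where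
  "is_subrep g n r \<rho> W \<longleftrightarrow> lin_subspace r W \<and>
    (\<forall>\<gamma>\<in>carrier (surf_group g n). \<forall>v\<in>W. \<rho> \<gamma> *\<^sub>v v \<in> W)"

definition sub_deg :: "nat \<Rightarrow> nat \<Rightarrow> (nat \<Rightarrow> nat) \<Rightarrow> (nat \<Rightarrow> nat \<Rightarrow> nat) \<Rightarrow> (nat \<Rightarrow> nat \<Rightarrow> real) \<Rightarrow>
    (nat \<Rightarrow> complex mat set) \<Rightarrow> complex vec set \<Rightarrow> real" where
  "sub_deg n r s d w P W =
    (\<Sum>i=1..n. let F = flag_of r (s i) (d i) (P i) in
      \<Sum>l=0..s i. w i l * real (quot_dim r (F l \<inter> W) (F (Suc l) \<inter> W)))"

definition sub_slope :: "nat \<Rightarrow> nat \<Rightarrow> (nat \<Rightarrow> nat) \<Rightarrow> (nat \<Rightarrow> nat \<Rightarrow> nat) \<Rightarrow> (nat \<Rightarrow> nat \<Rightarrow> real) \<Rightarrow>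
    (nat \<Rightarrow> complex mat set) \<Rightarrow> complex vec set \<Rightarrow> real" where
  "sub_slope n r s d w P W = sub_deg n r s d w P W / real (sdim r W)"

definition pair_semistable :: "nat \<Rightarrow> nat \<Rightarrow> nat \<Rightarrow> (nat \<Rightarrow> nat) \<Rightarrow> (nat \<Rightarrow> nat \<Rightarrow> nat) \<Rightarrow>
    (nat \<Rightarrow> nat \<Rightarrow> real) \<Rightarrow> prp_pair \<Rightarrow> bool" where
  "pair_semistable g n r s d w = (\<lambda>(\<rho>, P).
    \<forall>W. is_subrep g n r \<rho> W \<and> W \<noteq> {0\<^sub>v r} \<and> W \<noteq> carrier_vec r \<longrightarrow>
      sub_slope n r s d w P W \<le> pair_slope n r s d w)"

definition PRP_ss :: "nat \<Rightarrow> nat \<Rightarrow> nat \<Rightarrow> (nat \<Rightarrow> nat) \<Rightarrow> (nat \<Rightarrow> nat \<Rightarrow> nat) \<Rightarrow>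
    (nat \<Rightarrow> nat \<Rightarrow> real) \<Rightarrow> prp_pair set" where
  "PRP_ss g n r s d w = {p \<in> PRP g n r s d. pair_semistable g n r s d w p}"


section \<open>Quiver representations\<close>

text \<open>The head and tail of an arc are its target and source. A representation assigns to an arc
  \<open>a\<close> a matrix with \<open>d (head Q a)\<close> rows and \<open>d (tail Q a)\<close> columns.\<close>

definition REP :: "('v, 'e) pre_digraph \<Rightarrow> ('v \<Rightarrow> nat) \<Rightarrow> ('e \<Rightarrow> complex mat) set" where
  "REP Q d = (\<Pi>\<^sub>E a\<in>arcs Q. carrier_mat (d (head Q a)) (d (tail Q a)))"

definition is_quiver_subrep ::
    "('v, 'e) pre_digraph \<Rightarrow> ('v \<Rightarrow> nat) \<Rightarrow> ('e \<Rightarrow> complex mat) \<Rightarrow> ('v \<Rightarrow> complex vec set) \<Rightarrow> bool" where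
  "is_quiver_subrep Q d x W \<longleftrightarrow>
    (\<forall>v\<in>verts Q. lin_subspace (d v) (W v)) \<and>
    (\<forall>a\<in>arcs Q. \<forall>y\<in>W (tail Q a). x a *\<^sub>v y \<in> W (head Q a))"

definition quiver_semistable :: "('v, 'e) pre_digraph \<Rightarrow> ('v \<Rightarrow> nat) \<Rightarrow> ('v \<Rightarrow> real) \<Rightarrow>
    ('e \<Rightarrow> complex mat) \<Rightarrow> bool" where
  "quiver_semistable Q d \<theta> x \<longleftrightarrow>
    (\<forall>W. is_quiver_subrep Q d x W \<and> (\<exists>v\<in>verts Q. W v \<noteq> carrier_vec (d v)) \<longrightarrow>
      (\<Sum>v\<in>verts Q. \<theta> v * real (sdim (d v) (W v))) \<le> 0)"

definition REP_ss :: "('v, 'e) pre_digraph \<Rightarrow> ('v \<Rightarrow> nat) \<Rightarrow> ('v \<Rightarrow> real) \<Rightarrow>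
    ('e \<Rightarrow> complex mat) set" where
  "REP_ss Q d \<theta> = {x \<in> REP Q d. quiver_semistable Q d \<theta> x}"


section \<open>The quiver attached to parabolic representation pairs\<close>

text \<open>\<open>Hub\<close> is the vertex \<open>u\<close>, and \<open>Leg i l\<close> with \<open>l \<ge> 1\<close> is \<open>u\<^sup>(\<^sup>i\<^sup>)\<^sub>l\<close>. The function \<open>vtx\<close>
  implements the convention that \<open>u\<^sup>(\<^sup>i\<^sup>)\<^sub>0 = u\<close>. The arc \<open>ArrC i l\<close> is the loop \<open>c\<^sup>(\<^sup>i\<^sup>)\<^sub>l\<close>,
  where \<open>c\<^sup>(\<^sup>i\<^sup>)\<^sub>0 = c\<^sup>(\<^sup>i\<^sup>)\<close> is based at \<open>u\<close>.\<close>

datatype qvert = Hub | Leg nat nat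
datatype qarr = ArrA nat | ArrB nat | ArrC nat nat | ArrE nat nat

definition vtx :: "nat \<Rightarrow> nat \<Rightarrow> qvert" where
  "vtx i l = (if l = 0 then Hub else Leg i l)"

fun qtail :: "qarr \<Rightarrow> qvert" where
  "qtail (ArrA j) = Hub"
| "qtail (ArrB j) = Hub"
| "qtail (ArrC i l) = vtx i l"
| "qtail (ArrE i l) = vtx i l"

fun qhead :: "qarr \<Rightarrow> qvert" where
  "qhead (ArrA j) = Hub"
| "qhead (ArrB j) = Hub"
| "qhead (ArrC i l) = vtx i l"
| "qhead (ArrE i l) = vtx i (l - 1)"

definition prp_quiver :: "nat \<Rightarrow> nat \<Rightarrow> (nat \<Rightarrow> nat) \<Rightarrow> (qvert, qarr) pre_digraph" where
  "prp_quiver g n s =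
    \<lparr>verts = insert Hub {Leg i l | i l. i \<in> {1..n} \<and> l \<in> {1..s i}},
     arcs = ArrA ` {1..g} \<union> ArrB ` {1..g} \<union> {ArrC i l | i l. i \<in> {1..n} \<and> l \<in> {0..s i}}
       \<union> {ArrE i l | i l. i \<in> {1..n} \<and> l \<in> {1..s i}},
     tail = qtail, head = qhead\<rparr>"

fun dimQ :: "nat \<Rightarrow> (nat \<Rightarrow> nat) \<Rightarrow> (nat \<Rightarrow> nat \<Rightarrow> nat) \<Rightarrow> qvert \<Rightarrow> nat" where
  "dimQ r s d Hub = r"
| "dimQ r s d (Leg i l) = (\<Sum>m=l..s i. d i m)"

fun weightQ :: "nat \<Rightarrow> nat \<Rightarrow> (nat \<Rightarrow> nat) \<Rightarrow> (nat \<Rightarrow> nat \<Rightarrow> nat) \<Rightarrow> (nat \<Rightarrow> nat \<Rightarrow> real) \<Rightarrow> qvert \<Rightarrow> real" where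
  "weightQ n r s d w Hub =
    - (1 / real r) * (\<Sum>i=1..n. \<Sum>l=0..s i. w i l * real (d i l)) + (\<Sum>i=1..n. w i 0)"
| "weightQ n r s d w (Leg i l) = w i l - w i (l - 1)"

definition grp_commutator :: "('a, 'b) monoid_scheme \<Rightarrow> 'a \<Rightarrow> 'a \<Rightarrow> 'a" where
  "grp_commutator G a b = a \<otimes>\<^bsub>G\<^esub> b \<otimes>\<^bsub>G\<^esub> inv\<^bsub>G\<^esub> a \<otimes>\<^bsub>G\<^esub> inv\<^bsub>G\<^esub> b"

definition REP_prp ::
    "nat \<Rightarrow> nat \<Rightarrow> nat \<Rightarrow> (nat \<Rightarrow> nat) \<Rightarrow> (nat \<Rightarrow> nat \<Rightarrow> nat) \<Rightarrow> (qarr \<Rightarrow> complex mat) set" where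
  "REP_prp g n r s d =
    {x \<in> REP (prp_quiver g n s) (dimQ r s d).
      (\<forall>a\<in>arcs (prp_quiver g n s). inj_on (\<lambda>v. x a *\<^sub>v v) (carrier_vec (dimQ r s d (qtail a)))) \<and>
      (\<forall>i\<in>{1..n}. \<forall>l\<in>{1..s i}. x (ArrC i (l - 1)) * x (ArrE i l) = x (ArrE i l) * x (ArrC i l)) \<and>
      grp_list_prod (GL r) (map (\<lambda>j. grp_commutator (GL r) (x (ArrA j)) (x (ArrB j))) [1..<Suc g]
        @ map (\<lambda>i. x (ArrC i 0)) [1..<Suc n]) = 1\<^sub>m r}"


section \<open>The map from quiver representations to parabolic representation pairs\<close>

text \<open>For \<open>x\<close> in \<open>REP_prp\<close> there is exactly one such homomorphism, see \<open>ex1_rho_of\<close> below.\<close>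

definition rho_of :: "nat \<Rightarrow> nat \<Rightarrow> nat \<Rightarrow> (qarr \<Rightarrow> complex mat) \<Rightarrow> surf_gen word set \<Rightarrow> complex mat" where
  "rho_of g n r x = (THE \<rho>.
    \<rho> \<in> hom (surf_group g n) (GL r) \<and> \<rho> \<in> extensional (carrier (surf_group g n)) \<and>
    (\<forall>j\<in>{1..g}. \<rho> (surf_elt g n (Alpha j)) = x (ArrA j) \<and> \<rho> (surf_elt g n (Beta j)) = x (ArrB j)) \<and>
    (\<forall>i\<in>{1..n}. \<rho> (surf_elt g n (Gamma i)) = x (ArrC i 0)))"

lemma fin_digraph_prp_quiver: "fin_digraph (prp_quiver g n s)"
proof
  have V: "{Leg i l | i l. i \<in> {1..n} \<and> l \<in> {1..s i}} = (\<lambda>(i, l). Leg i l) ` (SIGMA i:{1..n}. {1..s i})"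
    by auto
  have E: "{ArrE i l | i l. i \<in> {1..n} \<and> l \<in> {1..s i}} = (\<lambda>(i, l). ArrE i l) ` (SIGMA i:{1..n}. {1..s i})"
    by auto
  have C: "{ArrC i l | i l. i \<in> {1..n} \<and> l \<in> {0..s i}} = (\<lambda>(i, l). ArrC i l) ` (SIGMA i:{1..n}. {0..s i})"
    by auto
  show "finite (verts (prp_quiver g n s))" "finite (arcs (prp_quiver g n s))"
    unfolding prp_quiver_def V E C by auto
qed (auto simp: prp_quiver_def vtx_def split: if_splits)

lemma ex1_rho_of:
  assumes x: "x \<in> REP_prp g n r s d"
  shows "\<exists>!\<rho>. \<rho> \<in> hom (surf_group g n) (GL r) \<and> \<rho> \<in> extensional (carrier (surf_group g n)) \<and>
    (\<forall>j\<in>{1..g}. \<rho> (surf_elt g n (Alpha j)) = x (ArrA j) \<and> \<rho> (surf_elt g n (Beta j)) = x (ArrB j)) \<and>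
    (\<forall>i\<in>{1..n}. \<rho> (surf_elt g n (Gamma i)) = x (ArrC i 0))"
proof -
  interpret G: group "GL r" by (rule group_GL)
  define f where "f = (\<lambda>y. case y of Alpha j \<Rightarrow> x (ArrA j) | Beta j \<Rightarrow> x (ArrB j) | Gamma i \<Rightarrow> x (ArrC i 0))"
  have loop: "x a \<in> carrier (GL r)" if "a \<in> arcs (prp_quiver g n s)" "qtail a = Hub" "qhead a = Hub" for a
  proof (rule carrier_GL_if_inj)
    have "x a \<in> carrier_mat (dimQ r s d (head (prp_quiver g n s) a)) (dimQ r s d (tail (prp_quiver g n s) a))"
      using x that(1) unfolding REP_prp_def REP_def by blast
    then show "x a \<in> carrier_mat r r" using that by (simp add: prp_quiver_def)
    have "inj_on (\<lambda>v. x a *\<^sub>v v) (carrier_vec (dimQ r s d (qtail a)))"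
      using x that(1) unfolding REP_prp_def by blast
    then show "inj_on (\<lambda>v. x a *\<^sub>v v) (carrier_vec r)" using that by simp
  qed
  have A: "x (ArrA j) \<in> carrier (GL r)" and B: "x (ArrB j) \<in> carrier (GL r)" if "j \<in> {1..g}" for j
    using that by (auto intro!: loop simp: prp_quiver_def)
  have C: "x (ArrC i 0) \<in> carrier (GL r)" if "i \<in> {1..n}" for i
    using that by (auto intro!: loop simp: prp_quiver_def vtx_def)
  have f: "f \<in> surf_gens g n \<rightarrow> carrier (GL r)"
    using A B C by (auto simp: surf_gens_def f_def)
  define rl where "rl = (\<lambda>j. [(Alpha j, True), (Beta j, True), (Alpha j, False), (Beta j, False)])"
  have rl_in: "rl j \<in> lists (surf_gens g n \<times> UNIV)" if "j \<in> {1..g}" for j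
    using that unfolding rl_def surf_gens_def by auto
  have concat_in: "concat (map rl js) \<in> lists (surf_gens g n \<times> UNIV)" if "set js \<subseteq> {1..g}" for js
    using that
  proof (induction js)
    case (Cons j js)
    then show ?case using rl_in[of j] by auto
  qed simp
  have comm: "word_val (GL r) f (concat (map rl js)) =
      grp_list_prod (GL r) (map (\<lambda>j. grp_commutator (GL r) (x (ArrA j)) (x (ArrB j))) js)"
    if "set js \<subseteq> {1..g}" for js
    using that
  proof (induction js)
    case Nil
    then show ?case by (simp add: word_val_def)
  next
    case (Cons j js)
    have j: "rl j \<in> lists (surf_gens g n \<times> UNIV)" "concat (map rl js) \<in> lists (surf_gens g n \<times> UNIV)"
      using Cons.prems by (simp add: rl_in, intro concat_in) auto
    have "word_val (GL r) f (rl j) = grp_commutator (GL r) (x (ArrA j)) (x (ArrB j))"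
      using A[of j] B[of j] Cons.prems
      by (simp add: word_val_def rl_def f_def grp_commutator_def G.m_assoc)
    then show ?case using Cons G.word_val_append[OF f j] by simp
  qed
  have in1: "concat (map rl [1..<Suc g]) \<in> lists (surf_gens g n \<times> UNIV)"
    by (rule concat_in) auto
  have in2: "map (\<lambda>i. (Gamma i, True)) [1..<Suc n] \<in> lists (surf_gens g n \<times> UNIV)"
    by (auto simp: surf_gens_def)
  have "word_val (GL r) f (surf_relator g n) =
      grp_list_prod (GL r) (map (\<lambda>j. grp_commutator (GL r) (x (ArrA j)) (x (ArrB j))) [1..<Suc g]) \<otimes>\<^bsub>GL r\<^esub>
      word_val (GL r) f (map (\<lambda>i. (Gamma i, True)) [1..<Suc n])"
    unfolding surf_relator_def rl_def[symmetric] G.word_val_append[OF f in1 in2]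
    by (subst comm) (auto simp: less_Suc_eq_le)
  also have "word_val (GL r) f (map (\<lambda>i. (Gamma i, True)) [1..<Suc n]) =
      grp_list_prod (GL r) (map (\<lambda>i. x (ArrC i 0)) [1..<Suc n])"
    by (simp add: word_val_def f_def comp_def del: upt_Suc)
  also have "grp_list_prod (GL r) (map (\<lambda>j. grp_commutator (GL r) (x (ArrA j)) (x (ArrB j))) [1..<Suc g]) \<otimes>\<^bsub>GL r\<^esub>
      grp_list_prod (GL r) (map (\<lambda>i. x (ArrC i 0)) [1..<Suc n]) =
      grp_list_prod (GL r) (map (\<lambda>j. grp_commutator (GL r) (x (ArrA j)) (x (ArrB j))) [1..<Suc g]
        @ map (\<lambda>i. x (ArrC i 0)) [1..<Suc n])"
    using A B C by (intro G.grp_list_prod_append[symmetric]) (auto simp: grp_commutator_def less_Suc_eq_le simp del: upt_Suc)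
  also have "\<dots> = 1\<^sub>m r" using x by (simp add: REP_prp_def)
  also have "1\<^sub>m r = \<one>\<^bsub>GL r\<^esub>" by (simp add: GL_def units_of_one ring_mat_simps)
  finally have rel: "word_val (GL r) f z = \<one>\<^bsub>GL r\<^esub>" if "z \<in> {surf_relator g n}" for z
    using that by simp
  have "(\<forall>y\<in>surf_gens g n. \<rho> (surf_elt g n y) = f y) \<longleftrightarrow>
    (\<forall>j\<in>{1..g}. \<rho> (surf_elt g n (Alpha j)) = x (ArrA j) \<and> \<rho> (surf_elt g n (Beta j)) = x (ArrB j)) \<and>
    (\<forall>i\<in>{1..n}. \<rho> (surf_elt g n (Gamma i)) = x (ArrC i 0))" for \<rho>
    by (auto simp: surf_gens_def f_def)
  then show ?thesis
    using G.ex1_hom_presented_group[OF f rel, of "{surf_relator g n}"]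
    by (simp add: surf_group_def surf_elt_def)
qed

text \<open>The matrix of \<open>x\<^bsub>e 1\<^esub> \<circ> \<dots> \<circ> x\<^bsub>e l\<^esub>\<close> along leg \<open>i\<close>; for \<open>l = 0\<close> this is the identity of \<open>\<complex>\<^sup>r\<close>.\<close>

definition leg_map :: "nat \<Rightarrow> (nat \<Rightarrow> nat) \<Rightarrow> (nat \<Rightarrow> nat \<Rightarrow> nat) \<Rightarrow> (qarr \<Rightarrow> complex mat) \<Rightarrow>
    nat \<Rightarrow> nat \<Rightarrow> complex mat" where
  "leg_map r s d x i l = foldr (*) (map (\<lambda>m. x (ArrE i m)) [1..<Suc l]) (1\<^sub>m (dimQ r s d (vtx i l)))"

definition image_flag :: "nat \<Rightarrow> (nat \<Rightarrow> nat) \<Rightarrow> (nat \<Rightarrow> nat \<Rightarrow> nat) \<Rightarrow> (qarr \<Rightarrow> complex mat) \<Rightarrow>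
    nat \<Rightarrow> nat \<Rightarrow> complex vec set" where
  "image_flag r s d x i = (\<lambda>l\<in>{0..Suc (s i)}.
    if l \<le> s i then (\<lambda>v. leg_map r s d x i l *\<^sub>v v) ` carrier_vec (dimQ r s d (vtx i l)) else {0\<^sub>v r})"

definition phi :: "nat \<Rightarrow> nat \<Rightarrow> nat \<Rightarrow> (nat \<Rightarrow> nat) \<Rightarrow> (nat \<Rightarrow> nat \<Rightarrow> nat) \<Rightarrow>
    (qarr \<Rightarrow> complex mat) \<Rightarrow> prp_pair" where
  "phi g n r s d x =
    (rho_of g n r x, \<lambda>i\<in>{1..n}. flag_stabilizer r (s i) (image_flag r s d x i))"

text \<open>The map \<open>\<phi>\<close> has domain \<open>REP_prp\<close>, so preimages are taken inside this set.\<close>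

definition phi_preimage :: "nat \<Rightarrow> nat \<Rightarrow> nat \<Rightarrow> (nat \<Rightarrow> nat) \<Rightarrow> (nat \<Rightarrow> nat \<Rightarrow> nat) \<Rightarrow>
    prp_pair set \<Rightarrow> (qarr \<Rightarrow> complex mat) set" where
  "phi_preimage g n r s d B = {x \<in> REP_prp g n r s d. phi g n r s d x \<in> B}"

end

theory Submission
  imports Defs "Jordan_Normal_Form.DL_Rank"
begin

text \<open>A subrepresentation of the pair \<open>(\<rho>, P) = phi x\<close> is a subspace \<open>U\<close> of \<open>\<complex>\<^sup>r\<close> stable under the loops
of \<open>x\<close> at the hub. A quiver subrepresentation \<open>W\<close> has such a subspace \<open>U\<close> at the hub, and on the legs
it consists of subspaces that the injective maps along the legs carry into \<open>F i l \<inter> U\<close>, where \<open>F i\<close>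
is the flag of images. Conversely, every stable \<open>U\<close> occurs, and the largest \<open>W\<close> over it, its
saturation, has the full preimages of \<open>U\<close> on the legs, of dimension \<open>dim (F i l \<inter> U)\<close>.

Summation by parts of the degree of \<open>U\<close> produces the coefficients \<open>w i l - w i (l - 1)\<close>, which are
the quiver weights on the legs, and gives (\<open>quiver_deg_eq\<close>)

\<open>weight W = deg U - slope * dim U - (\<Sum>i l. (w i l - w i (l - 1)) * (dim (F i l \<inter> U) - dim (W i l)))\<close>

with \<open>l \<ge> 1\<close> and the slope of the pair. Since the weights increase, the sum is nonnegative, and it
vanishes for the saturation. So for \<open>U \<noteq> 0\<close> the weights of the quiver subrepresentations over \<open>U\<close> are all
nonpositive if and only if the slope of \<open>U\<close> is at most the slope of the pair. The
subspaces \<open>U = 0\<close> and \<open>U = \<complex>\<^sup>r\<close>, which the semistability of pairs excludes, satisfy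
\<open>deg U = slope * dim U\<close> and hence impose no condition on the quiver side either.

Two further points have to be checked. The pair records a flag only through its stabilizer in
\<open>GL\<close>, so the flag has to be recovered from the stabilizer (\<open>flag_of_stabilizer\<close>): the stabilizer is
so large that its only invariant subspaces are the steps of the flag. And stability under
\<open>\<rho>\<close> of the whole surface group has to be reduced to the generators
(\<open>presented_group_hom_invariant\<close>).\<close>

section \<open>Subspaces of coordinate spaces and their dimensions\<close>

lemma lin_subspace_iff:
  "lin_subspace m W \<longleftrightarrow> W \<subseteq> carrier_vec m \<and> 0\<^sub>v m \<in> W \<and>
    (\<forall>u\<in>W. \<forall>v\<in>W. u + v \<in> W) \<and> (\<forall>c. \<forall>v\<in>W. c \<cdot>\<^sub>v v \<in> W)"
  using vec_vs[of m, where 'a=complex] vec_module[of m, where 'a=complex]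
  by (auto simp: VectorSpace.subspace_def submodule_def module_vec_simps)

lemma lin_subspaceD:
  assumes "lin_subspace m W"
  shows "W \<subseteq> carrier_vec m" "0\<^sub>v m \<in> W" "\<And>u v. u \<in> W \<Longrightarrow> v \<in> W \<Longrightarrow> u + v \<in> W"
    "\<And>c v. v \<in> W \<Longrightarrow> c \<cdot>\<^sub>v v \<in> W"
  using assms unfolding lin_subspace_iff by blast+

lemma lin_subspace_carrier: "lin_subspace m (carrier_vec m)"
  by (auto simp: lin_subspace_iff)

lemma lin_subspace_zero: "lin_subspace m {0\<^sub>v m}"
  by (auto simp: lin_subspace_iff)

lemma lin_subspace_Int: "lin_subspace m U \<Longrightarrow> lin_subspace m W \<Longrightarrow> lin_subspace m (U \<inter> W)"
  unfolding lin_subspace_iff by blast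

lemma lin_subspace_image:
  assumes A: "A \<in> carrier_mat m k" and U: "lin_subspace k U"
  shows "lin_subspace m ((\<lambda>v. A *\<^sub>v v) ` U)"
proof -
  note U' = lin_subspaceD[OF U]
  have "A *\<^sub>v 0\<^sub>v k = 0\<^sub>v m" using A by (intro eq_vecI) auto
  moreover have "A *\<^sub>v u + A *\<^sub>v v = A *\<^sub>v (u + v)" if "u \<in> U" "v \<in> U" for u v
    using mult_add_distrib_mat_vec[OF A, of u v] that U'(1) by (simp add: subset_iff)
  moreover have "c \<cdot>\<^sub>v (A *\<^sub>v v) = A *\<^sub>v (c \<cdot>\<^sub>v v)" if "v \<in> U" for c v
    using mult_mat_vec[OF A, of v c] that U'(1) by (simp add: subset_iff)
  moreover have "(\<lambda>v. A *\<^sub>v v) ` U \<subseteq> carrier_vec m" using A U'(1) by auto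
  ultimately show ?thesis
    unfolding lin_subspace_iff using U'(2-4) by (simp add: image_iff) metis
qed

lemma lin_subspace_vimage:
  assumes A: "A \<in> carrier_mat m k" and W: "lin_subspace m W"
  shows "lin_subspace k {v \<in> carrier_vec k. A *\<^sub>v v \<in> W}"
proof -
  have "A *\<^sub>v 0\<^sub>v k = 0\<^sub>v m" using A by (intro eq_vecI) auto
  then show ?thesis
    unfolding lin_subspace_iff using lin_subspaceD[OF W] mult_add_distrib_mat_vec[OF A] mult_mat_vec[OF A]
    by auto
qed

text \<open>A linearly independent subset of a subspace is linearly independent in the whole space, so its
size is bounded; one that is maximal inside the subspace is a basis of it.\<close>

lemma (in vectorspace) subspace_basis_exists:
  assumes fd: "fin_dim" and W: "VectorSpace.subspace K W V"
  obtains B where "finite B" "B \<subseteq> W" "lin_indpt B" "vectorspace.basis K (vs W) B"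
proof -
  interpret W: vectorspace K "vs W" by (rule subspace_is_vs[OF W])
  have sub: "submodule K W V" by (rule is_module[OF W])
  have WV: "W \<subseteq> carrier V" using sub unfolding submodule_def by blast
  note same = span_li_not_depend[OF _ sub]
  have "\<exists>A. finite A \<and> maximal A (\<lambda>S. S \<subseteq> W \<and> W.lin_indpt S)"
  proof (rule maximal_exists)
    show "finite A \<and> card A \<le> dim" if "A \<subseteq> W \<and> W.lin_indpt A" for A
    proof -
      have "A \<subseteq> carrier V" "lin_indpt A" using that WV same(2)[of A] by auto
      then show ?thesis using li_le_dim[OF fd] by blast
    qed
    show "{} \<subseteq> W \<and> W.lin_indpt {}" by (simp add: W.lin_dep_def)
  qed
  then obtain A where A: "finite A" "maximal A (\<lambda>S. S \<subseteq> W \<and> W.lin_indpt S)" by blast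
  then have "W.basis A" by (intro W.max_li_is_basis) simp
  moreover have "A \<subseteq> W" "lin_indpt A" using A same(2)[of A] by (auto simp: maximal_def)
  ultimately show ?thesis using that A(1) by blast
qed

lemma (in vectorspace) subspace_fin_dim:
  assumes "fin_dim" "VectorSpace.subspace K W V"
  shows "vectorspace.fin_dim K (vs W)"
proof -
  interpret W: vectorspace K "vs W" by (rule subspace_is_vs[OF assms(2)])
  obtain B where "finite B" "W.basis B" using subspace_basis_exists[OF assms] by blast
  then show ?thesis unfolding W.fin_dim_def W.basis_def by blast
qed

lemma (in vectorspace) subspace_eq_if_dim_le:
  assumes fd: "fin_dim" and W: "VectorSpace.subspace K W V" and d: "dim \<le> vectorspace.dim K (vs W)"
  shows "W = carrier V"
proof -
  interpret W: vectorspace K "vs W" by (rule subspace_is_vs[OF W])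
  have sub: "submodule K W V" by (rule is_module[OF W])
  obtain B where B: "finite B" "B \<subseteq> W" "lin_indpt B" "W.basis B"
    using subspace_basis_exists[OF fd W] by blast
  have WV: "W \<subseteq> carrier V" using sub unfolding submodule_def by blast
  have "basis B"
    using B d WV W.dim_basis[OF B(1,4)] by (intro dim_li_is_basis[OF fd]) auto
  then have "carrier V = span B" by (simp add: basis_def)
  also have "\<dots> \<subseteq> W" by (rule span_is_subset[OF B(2) sub])
  finally show ?thesis using WV by blast
qed

lemma sdim_carrier: "sdim m (carrier_vec m) = m"
proof -
  interpret vec_space "TYPE(complex)" m .
  have "V\<lparr>carrier := carrier_vec m\<rparr> = V" by (simp add: module_vec_def)
  then show ?thesis unfolding sdim_def by (simp only: dim_is_n)
qed

lemma sdim_zero: "sdim m {0\<^sub>v m} = 0"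
proof -
  interpret vec_space "TYPE(complex)" m .
  have "span {} = {0\<^sub>v m}" using span_empty by simp
  then show ?thesis using dim_zero_vs by (simp add: sdim_def)
qed

lemma sdim_mono:
  assumes "lin_subspace m U" "lin_subspace m W" "U \<subseteq> W"
  shows "sdim m U \<le> sdim m W"
proof -
  interpret V: vec_space "TYPE(complex)" m .
  interpret W: vectorspace class_ring "V.vs W" by (rule V.subspace_is_vs[OF assms(2)])
  have "VectorSpace.subspace class_ring U (V.vs W)" by (rule V.nested_subspaces[OF assms(2,1,3)])
  from W.subspace_dim[OF this V.subspace_fin_dim[OF V.fin_dim assms(2)]]
  show ?thesis using V.subspace_fin_dim[OF V.fin_dim assms(1)] by (simp add: sdim_def)
qed

lemma sdim_eq_imp_eq:
  assumes "lin_subspace m U" "lin_subspace m W" "U \<subseteq> W" "sdim m W \<le> sdim m U"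
  shows "U = W"
proof -
  interpret V: vec_space "TYPE(complex)" m .
  interpret W: vectorspace class_ring "V.vs W" by (rule V.subspace_is_vs[OF assms(2)])
  have "VectorSpace.subspace class_ring U (V.vs W)" by (rule V.nested_subspaces[OF assms(2,1,3)])
  from W.subspace_eq_if_dim_le[OF V.subspace_fin_dim[OF V.fin_dim assms(2)] this] assms(4)
  show ?thesis by (simp add: sdim_def)
qed

lemma sdim_image:
  assumes A: "A \<in> carrier_mat m k" and U: "lin_subspace k U" and inj: "inj_on (\<lambda>v. A *\<^sub>v v) U"
  shows "sdim m ((\<lambda>v. A *\<^sub>v v) ` U) = sdim k U"
proof -
  interpret V: vec_space "TYPE(complex)" k .
  interpret W: vec_space "TYPE(complex)" m .
  let ?I = "(\<lambda>v. A *\<^sub>v v) ` U"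
  have I: "lin_subspace m ?I" by (rule lin_subspace_image[OF A U])
  interpret U: vectorspace class_ring "V.vs U" by (rule V.subspace_is_vs[OF U])
  interpret I: vectorspace class_ring "W.vs ?I" by (rule W.subspace_is_vs[OF I])
  interpret T: linear_map class_ring "V.vs U" "W.vs ?I" "\<lambda>v. A *\<^sub>v v"
  proof unfold_locales
    have "A *\<^sub>v (u + v) = A *\<^sub>v u + A *\<^sub>v v" "A *\<^sub>v (c \<cdot>\<^sub>v v) = c \<cdot>\<^sub>v (A *\<^sub>v v)"
      if "u \<in> U" "v \<in> U" for u v c
      using mult_add_distrib_mat_vec[OF A, of u v] mult_mat_vec[OF A, of v c] that
        lin_subspaceD(1)[OF U] by (simp_all add: subset_iff)
    then show "(\<lambda>v. A *\<^sub>v v) \<in> LinearCombinations.module_hom class_ring (V.vs U) (W.vs ?I)"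
      by (simp add: LinearCombinations.module_hom_def module_vec_simps)
  qed
  show ?thesis
    using T.dim_eq[OF V.subspace_fin_dim[OF V.fin_dim U]] inj by (simp add: sdim_def)
qed

text \<open>Extend a basis of \<open>U\<close> and the vector \<open>v\<close> to a basis of \<open>\<complex>\<^sup>m\<close>. The matrix with this basis as
columns is invertible, and the row of its inverse at the position of \<open>v\<close> is the coordinate
functional of \<open>v\<close>.\<close>

lemma separating_functional:
  assumes U: "lin_subspace m U" and v: "v \<in> carrier_vec m" "v \<notin> U"
  obtains f where "f \<in> carrier_vec m" "f \<bullet> v = 1" "\<And>u. u \<in> U \<Longrightarrow> f \<bullet> u = 0"
proof -
  interpret V: vec_space "TYPE(complex)" m .
  obtain B where B: "finite B" "B \<subseteq> U" "V.lin_indpt B" "vectorspace.basis class_ring (V.vs U) B"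
    using V.subspace_basis_exists[OF V.fin_dim U] by blast
  interpret U: vectorspace class_ring "V.vs U" by (rule V.subspace_is_vs[OF U])
  have sub: "submodule class_ring U V.V" by (rule V.is_module[OF U])
  have UV: "U \<subseteq> carrier_vec m" by (rule lin_subspaceD(1)[OF U])
  have spanB: "V.span B = U"
    using B(4) V.span_li_not_depend(1)[OF B(2) sub] by (simp add: U.basis_def)
  have BV: "B \<subseteq> carrier_vec m" using B(2) UV by blast
  have vB: "V.lin_indpt (insert v B)"
    using V.lin_dep_iff_in_span[of B v] BV B v spanB by auto
  let ?P = "\<lambda>S. S \<subseteq> carrier_vec m \<and> V.lin_indpt S \<and> insert v B \<subseteq> S"
  have "\<exists>S. finite S \<and> maximal S ?P"
  proof (rule maximal_exists)
    show "finite S \<and> card S \<le> m" if "?P S" for S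
      using V.li_le_dim[OF V.fin_dim, of S] that V.dim_is_n by auto
    show "?P (insert v B)" using vB BV v by auto
  qed
  then obtain S where S: "finite S" "maximal S ?P" by blast
  then have S': "S \<subseteq> carrier_vec m" "V.lin_indpt S" "insert v B \<subseteq> S" by (auto simp: maximal_def)
  have basis: "V.basis S"
  proof -
    have "T = S" if "S \<subseteq> T" "T \<subseteq> carrier_vec m" "V.lin_indpt T" for T
    proof -
      have "insert v B \<subseteq> T" using S'(3) that(1) by (rule subset_trans)
      then show ?thesis using S(2) that unfolding maximal_def by blast
    qed
    then have "maximal S (\<lambda>S. S \<subseteq> carrier_vec m \<and> V.lin_indpt S)"
      using S'(1,2) unfolding maximal_def by blast
    then show ?thesis by (rule V.max_li_is_basis)
  qed
  have card: "card S = m" using V.dim_basis[OF S(1) basis] V.dim_is_n by simp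
  obtain bs where bs: "set bs = S" "distinct bs" using finite_distinct_list[OF S(1)] by blast
  have len: "length bs = m" using bs card distinct_card by fastforce
  define M where "M = mat_of_cols m bs"
  have M: "M \<in> carrier_mat m m" using mat_of_cols_carrier(1)[of m bs] len by (simp add: M_def)
  have cols: "cols M = bs" using bs S' by (simp add: M_def)
  have "V.rank M = m"
    by (rule V.lin_indpt_full_rank[OF M]) (use cols bs S' in auto)
  then have "det M \<noteq> 0" using V.det_rank_iff[OF M] by simp
  then obtain N where N: "N \<in> carrier_mat m m" "N * M = 1\<^sub>m m"
    using det_non_zero_imp_unit[OF M] unfolding Units_def ring_mat_def by auto
  obtain p where p: "p < m" "bs ! p = v"
    using S' bs len by (metis in_set_conv_nth insert_subset)
  have dot: "row N p \<bullet> (bs ! j) = (if j = p then 1 else 0)" if "j < m" for j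
  proof -
    have "row N p \<bullet> (bs ! j) = (N * M) $$ (p, j)"
      using that p N(1) M cols len by (metis carrier_matD cols_nth index_mult_mat(1))
    then show ?thesis using N(2) that p by auto
  qed
  let ?f = "row N p"
  have f: "?f \<in> carrier_vec m" using N(1) p by auto
  show ?thesis
  proof (rule that[OF f])
    show "?f \<bullet> v = 1" using dot[OF p(1)] p by simp
    have K: "lin_subspace m {u \<in> carrier_vec m. ?f \<bullet> u = 0}"
      using f by (auto simp: lin_subspace_iff scalar_prod_add_distrib[of _ m])
    have "?f \<bullet> u = 0" if u: "u \<in> B" for u
    proof -
      obtain j where "j < m" "bs ! j = u" using u S' bs len by (metis in_set_conv_nth insert_subset subsetD)
      moreover have "u \<noteq> v" using u v B by blast
      ultimately show ?thesis using dot[of j] p by auto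
    qed
    then have "B \<subseteq> {u \<in> carrier_vec m. ?f \<bullet> u = 0}" using BV by auto
    from V.span_is_subset[OF this V.is_module[OF K]]
    show "?f \<bullet> u = 0" if "u \<in> U" for u using that spanB by auto
  qed
qed

section \<open>A flag is determined by its stabilizer\<close>

lemma invariant_image_eq:
  assumes A: "A \<in> carrier_mat m m" and W: "lin_subspace m W" and inj: "inj_on (\<lambda>v. A *\<^sub>v v) W"
    and sub: "\<And>v. v \<in> W \<Longrightarrow> A *\<^sub>v v \<in> W"
  shows "(\<lambda>v. A *\<^sub>v v) ` W = W"
proof (rule sdim_eq_imp_eq[OF lin_subspace_image[OF A W] W])
  show "(\<lambda>v. A *\<^sub>v v) ` W \<subseteq> W" using sub by blast
  show "sdim m W \<le> sdim m ((\<lambda>v. A *\<^sub>v v) ` W)" by (simp add: sdim_image[OF A W inj])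
qed

lemma GL_inj:
  assumes "A \<in> carrier (GL m)"
  shows "A \<in> carrier_mat m m" "inj_on (\<lambda>v. A *\<^sub>v v) (carrier_vec m)"
proof -
  obtain B where AB: "A \<in> carrier_mat m m" "B \<in> carrier_mat m m" "B * A = 1\<^sub>m m"
    using assms by (auto simp: GL_def units_of_carrier Units_def ring_mat_simps)
  then show "A \<in> carrier_mat m m" by simp
  show "inj_on (\<lambda>v. A *\<^sub>v v) (carrier_vec m)"
    by (rule inj_on_inverseI[where g = "\<lambda>v. B *\<^sub>v v"])
      (use AB assoc_mult_mat_vec[OF AB(2,1)] in simp)
qed

lemma GL_invariant_eq:
  assumes "A \<in> carrier (GL m)" "lin_subspace m W" "\<And>v. v \<in> W \<Longrightarrow> A *\<^sub>v v \<in> W"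
  shows "(\<lambda>v. A *\<^sub>v v) ` W = W"
  using invariant_image_eq[OF GL_inj(1)[OF assms(1)] assms(2)
      inj_on_subset[OF GL_inj(2)[OF assms(1)] lin_subspaceD(1)[OF assms(2)]] assms(3)] .

lemma flag_antimono:
  assumes F: "is_flag r s d F" and "l \<le> m" "m \<le> Suc s"
  shows "F m \<subseteq> F l"
  using assms(2,3)
proof (induction m rule: dec_induct)
  case (step m)
  then have "F (Suc m) \<subset> F m" using F by (auto simp: is_flag_def)
  then show ?case using step by auto
qed simp

lemma sdim_flag:
  assumes F: "is_flag r s d F" and "l \<le> Suc s"
  shows "sdim r (F l) = (\<Sum>m=l..s. d m)"
  using assms(2)
proof (induction l rule: inc_induct)
  case base
  then show ?case using F sdim_zero by (auto simp: is_flag_def)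
next
  case (step l)
  have "sdim r (F (Suc l)) \<le> sdim r (F l)"
    using F step by (intro sdim_mono) (auto simp: is_flag_def)
  moreover have "sdim r (F l) - sdim r (F (Suc l)) = d l"
    using F step.hyps by (auto simp: is_flag_def quot_dim_def)
  ultimately show ?case using step by (simp add: sum.atLeast_Suc_atMost)
qed

text \<open>The matrix is \<open>1 + c \<cdot> y f\<^sup>T\<close> for a functional \<open>f\<close> that vanishes on \<open>F (m + 1)\<close> and takes the value
\<open>1\<close> at \<open>v\<close>. It fixes \<open>F l\<close> pointwise for \<open>l > m\<close>, and for \<open>l \<le> m\<close> it moves vectors of \<open>F l\<close> only by
multiples of \<open>y \<in> F m \<subseteq> F l\<close>.\<close>

lemma rank_one_update_in_stabilizer:
  assumes F: "is_flag r s d F" and m: "m \<le> s"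
    and v: "v \<in> F m" "v \<notin> F (Suc m)" and y: "y \<in> F m"
  obtains A c where "A \<in> flag_stabilizer r s F" "c \<noteq> 0" "A *\<^sub>v v = v + c \<cdot>\<^sub>v y"
proof -
  have sub: "lin_subspace r (F l)" if "l \<le> Suc s" for l using F that by (auto simp: is_flag_def)
  have carr: "F l \<subseteq> carrier_vec r" if "l \<le> Suc s" for l by (rule lin_subspaceD(1)[OF sub[OF that]])
  have yr: "y \<in> carrier_vec r" and vr: "v \<in> carrier_vec r" using carr[of m] m y v by auto
  obtain f where f: "f \<in> carrier_vec r" "f \<bullet> v = 1" "\<And>u. u \<in> F (Suc m) \<Longrightarrow> f \<bullet> u = 0"
    using separating_functional[OF sub vr v(2)] m by auto
  \<comment> \<open>The determinant of \<open>1 + c \<cdot> y f\<^sup>T\<close> is \<open>1 + c (f \<bullet> y)\<close>; at least one of \<open>c = 1\<close> and \<open>c = 2\<close> makes it nonzero.\<close>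
  define c :: complex where "c = (if 1 + f \<bullet> y = 0 then 2 else 1)"
  have c: "c \<noteq> 0" "1 + c * (f \<bullet> y) \<noteq> 0"
  proof -
    show "c \<noteq> 0" by (simp add: c_def)
    have "1 + 2 * (f \<bullet> y) \<noteq> 0" if "1 + f \<bullet> y = 0"
    proof -
      have "f \<bullet> y = - 1" using that by (simp add: add_eq_0_iff)
      then show ?thesis by simp
    qed
    then show "1 + c * (f \<bullet> y) \<noteq> 0" by (auto simp: c_def)
  qed
  define A where "A = 1\<^sub>m r + mat r r (\<lambda>(i, j). c * y $ i * f $ j)"
  have A: "A \<in> carrier_mat r r" by (simp add: A_def)
  have Au: "A *\<^sub>v u = u + (c * (f \<bullet> u)) \<cdot>\<^sub>v y" if u: "u \<in> carrier_vec r" for u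
  proof -
    have "mat r r (\<lambda>(i, j). c * y $ i * f $ j) *\<^sub>v u = (c * (f \<bullet> u)) \<cdot>\<^sub>v y"
      using u yr f(1) by (intro eq_vecI)
        (auto simp: scalar_prod_def sum_distrib_left sum_distrib_right ac_simps intro!: sum.cong)
    then show ?thesis
      unfolding A_def using u by (subst add_mult_distrib_mat_vec[of _ r r]) auto
  qed
  have fA: "f \<bullet> (A *\<^sub>v u) = (1 + c * (f \<bullet> y)) * (f \<bullet> u)" if u: "u \<in> carrier_vec r" for u
    unfolding Au[OF u] using u yr f(1)
    by (subst scalar_prod_add_distrib[of _ r]) (auto simp: algebra_simps)
  have "inj_on (\<lambda>v. A *\<^sub>v v) (carrier_vec r)"
  proof (rule inj_onI)
    fix u u' assume u: "u \<in> carrier_vec r" "u' \<in> carrier_vec r" and eq: "A *\<^sub>v u = A *\<^sub>v u'"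
    have "f \<bullet> u = f \<bullet> u'" using fA[OF u(1)] fA[OF u(2)] eq c(2) by simp
    then have "u + (c * (f \<bullet> u)) \<cdot>\<^sub>v y = u' + (c * (f \<bullet> u)) \<cdot>\<^sub>v y" using Au u eq by simp
    then have eq: "(u + (c * (f \<bullet> u)) \<cdot>\<^sub>v y) $ i = (u' + (c * (f \<bullet> u)) \<cdot>\<^sub>v y) $ i" for i by simp
    have "u $ i = u' $ i" if "i < r" for i using eq[of i] u yr that by simp
    then show "u = u'" using u by (intro eq_vecI) auto
  qed
  then have AG: "A \<in> carrier (GL r)" by (rule carrier_GL_if_inj[OF A])
  have inv: "A *\<^sub>v u \<in> F l" if l: "l \<le> Suc s" and u: "u \<in> F l" for l u
  proof (cases "l \<le> m")
    case True
    then have "y \<in> F l" using y flag_antimono[OF F, of l m] m by auto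
    then show ?thesis using Au[of u] carr[OF l] u lin_subspaceD(3,4)[OF sub[OF l]] by auto
  next
    case False
    then have "u \<in> F (Suc m)" using u flag_antimono[OF F, of "Suc m" l] l by auto
    then have "A *\<^sub>v u = u + 0 \<cdot>\<^sub>v y" using Au[of u] carr[OF l] u f(3) by auto
    also have "\<dots> = u"
    proof -
      have "u \<in> carrier_vec r" using u carr[OF l] by blast
      then show ?thesis using yr by (intro eq_vecI) auto
    qed
    finally show ?thesis using u by simp
  qed
  have "A \<in> flag_stabilizer r s F"
    using AG GL_invariant_eq[OF AG sub inv] by (auto simp: flag_stabilizer_def)
  then show ?thesis using that c(1) Au[OF vr] f(2) by simp
qed

text \<open>Let \<open>F m\<close> be the smallest step of the flag that contains \<open>W\<close>. A vector of \<open>W\<close> outside \<open>F (m + 1)\<close>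
can be moved by any prescribed \<open>y \<in> F m\<close>, up to a nonzero factor, by an element of the stabilizer;
hence \<open>F m \<subseteq> W\<close>.\<close>

lemma stabilizer_invariant_subspace:
  assumes F: "is_flag r s d F" and W: "lin_subspace r W"
    and inv: "\<And>A v. A \<in> flag_stabilizer r s F \<Longrightarrow> v \<in> W \<Longrightarrow> A *\<^sub>v v \<in> W"
  shows "\<exists>l\<le>Suc s. W = F l"
proof -
  let ?L = "{l. l \<le> Suc s \<and> W \<subseteq> F l}"
  have fin: "finite ?L" by simp
  have "0 \<in> ?L" using F lin_subspaceD(1)[OF W] by (auto simp: is_flag_def)
  then have m: "Max ?L \<in> ?L" using fin by (intro Max_in) auto
  define m where "m = Max ?L"
  have mL: "m \<le> Suc s" "W \<subseteq> F m" using m by (auto simp: m_def)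
  show ?thesis
  proof (cases "m = Suc s")
    case True
    then have "W = F m" using mL F lin_subspaceD(2)[OF W] by (auto simp: is_flag_def)
    then show ?thesis using mL by blast
  next
    case False
    have "Suc m \<notin> ?L" using Max_ge[OF fin, of "Suc m"] unfolding m_def[symmetric] by linarith
    then obtain v where v: "v \<in> W" "v \<notin> F (Suc m)" using False mL by auto
    have Fm: "F m \<subseteq> carrier_vec r"
      using lin_subspaceD(1) F mL by (auto simp: is_flag_def)
    have "y \<in> W" if y: "y \<in> F m" for y
    proof -
      obtain A c where A: "A \<in> flag_stabilizer r s F" "c \<noteq> 0" "A *\<^sub>v v = v + c \<cdot>\<^sub>v y"
        using rank_one_update_in_stabilizer[OF F _ _ v(2) y] v mL False by auto
      have "v + c \<cdot>\<^sub>v y \<in> W" using inv[OF A(1) v(1)] A(3) by simp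
      then have "inverse c \<cdot>\<^sub>v ((- 1) \<cdot>\<^sub>v v + (v + c \<cdot>\<^sub>v y)) \<in> W"
        using v(1) lin_subspaceD(3,4)[OF W] by blast
      also have "inverse c \<cdot>\<^sub>v ((- 1) \<cdot>\<^sub>v v + (v + c \<cdot>\<^sub>v y)) = y"
      proof -
        have "v \<in> carrier_vec r" "y \<in> carrier_vec r" using v(1) y Fm mL(2) by blast+
        then show ?thesis using A(2) by (intro eq_vecI) auto
      qed
      finally show ?thesis .
    qed
    then show ?thesis using mL by blast
  qed
qed

text \<open>Each step of \<open>F'\<close> is invariant under the stabilizer of \<open>F\<close>, hence is a step of \<open>F\<close>, and the
dimensions, which the type \<open>d\<close> prescribes, tell which one.\<close>

lemma flag_eq_if_stabilizer_eq:
  assumes F: "is_flag r s d F" and F': "is_flag r s d F'"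
    and eq: "flag_stabilizer r s F' = flag_stabilizer r s F"
  shows "F' = F"
proof (rule extensionalityI)
  show "F' \<in> extensional {0..Suc s}" "F \<in> extensional {0..Suc s}"
    using F F' by (auto simp: is_flag_def)
  fix l assume "l \<in> {0..Suc s}"
  then have l: "l \<le> Suc s" by simp
  have sub: "lin_subspace r (F m)" if "m \<le> Suc s" for m using F that by (auto simp: is_flag_def)
  have sub': "lin_subspace r (F' l)" using F' l by (auto simp: is_flag_def)
  have "A *\<^sub>v v \<in> F' l" if "A \<in> flag_stabilizer r s F" "v \<in> F' l" for A v
  proof -
    have "A \<in> flag_stabilizer r s F'" using that(1) eq by simp
    then have "(\<lambda>v. A *\<^sub>v v) ` F' l = F' l" using l by (simp add: flag_stabilizer_def)
    then show ?thesis using that(2) by blast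
  qed
  then obtain m where m: "m \<le> Suc s" "F' l = F m"
    using stabilizer_invariant_subspace[OF F sub'] by blast
  have dim: "sdim r (F m) = sdim r (F l)"
    using sdim_flag[OF F l] sdim_flag[OF F' l] m(2) by simp
  show "F' l = F l"
  proof (cases "l \<le> m")
    case True
    then show ?thesis
      using sdim_eq_imp_eq[OF sub[OF m(1)] sub[OF l]] flag_antimono[OF F _ m(1)] dim m(2) by simp
  next
    case False
    then show ?thesis
      using sdim_eq_imp_eq[OF sub[OF l] sub[OF m(1)]] flag_antimono[OF F _ l] dim m(2) by simp
  qed
qed

lemma flag_of_stabilizer:
  assumes "is_flag r s d F"
  shows "flag_of r s d (flag_stabilizer r s F) = F"
  unfolding flag_of_def
  by (rule the_equality) (use assms flag_eq_if_stabilizer_eq[OF assms] in blast)+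

section \<open>Subspaces invariant under a group given by generators\<close>

lemma GL_simps: "A \<otimes>\<^bsub>GL m\<^esub> B = A * B" "\<one>\<^bsub>GL m\<^esub> = 1\<^sub>m m"
  by (simp_all add: GL_def units_of_mult units_of_one ring_mat_simps)

text \<open>Invariance under the generators suffices because the inverse of a generator comes for free: an
injective linear map that sends a finite-dimensional space \<open>W\<close> into itself maps it onto itself.\<close>

lemma presented_group_hom_invariant:
  assumes h: "h \<in> hom (presented_group S R) (GL m)" and W: "lin_subspace m W"
    and gen: "\<And>y v. y \<in> S \<Longrightarrow> v \<in> W \<Longrightarrow> h (pres_gen S R y) *\<^sub>v v \<in> W"
    and c: "c \<in> carrier (presented_group S R)" and v: "v \<in> W"
  shows "h c *\<^sub>v v \<in> W"
proof -
  let ?H = "presented_group S R"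
  interpret H: group ?H by (rule group_presented_group)
  interpret G: group "GL m" by (rule group_GL)
  interpret h: group_hom ?H "GL m" h by unfold_locales (rule h)
  have hm: "h a \<in> carrier_mat m m" if "a \<in> carrier ?H" for a
    using GL_inj(1) h.hom_closed[OF that] .
  have Wm: "W \<subseteq> carrier_vec m" by (rule lin_subspaceD(1)[OF W])
  have act: "h (a \<otimes>\<^bsub>?H\<^esub> b) *\<^sub>v v = h a *\<^sub>v (h b *\<^sub>v v)"
    if "a \<in> carrier ?H" "b \<in> carrier ?H" "v \<in> carrier_vec m" for a b v
    using that hm assoc_mult_mat_vec[of "h a" m m "h b" m v] by (simp add: GL_simps)
  have act_one: "h \<one>\<^bsub>?H\<^esub> *\<^sub>v v = v" if "v \<in> carrier_vec m" for v
    using that h.hom_one by (simp add: GL_simps)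
  have letter: "h (word_cong S R `` {[(y, b)]}) *\<^sub>v v \<in> W" if y: "y \<in> S" and v: "v \<in> W" for y b v
  proof (cases b)
    case True
    then show ?thesis using gen[OF y v] by (simp add: pres_gen_def)
  next
    case False
    have cl: "word_cong S R `` {[(y, False)]} \<in> carrier ?H"
      using y by (intro class_in_presented_group) auto
    have "([] @ [(y, False), (y, \<not> False)] @ [], [] @ []) \<in> word_cong S R"
      using y by (intro word_cong.cancel) auto
    then have inv: "word_cong S R `` {[(y, False)]} \<otimes>\<^bsub>?H\<^esub> pres_gen S R y = \<one>\<^bsub>?H\<^esub>"
      using y by (simp add: pres_gen_def presented_group_mult presented_group_one word_class_eq_iff)
    have py: "pres_gen S R y \<in> carrier ?H" by (rule pres_gen_closed[OF y])
    have "(\<lambda>v. h (pres_gen S R y) *\<^sub>v v) ` W = W"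
      by (rule GL_invariant_eq[OF h.hom_closed[OF py] W gen[OF y]])
    then obtain v' where v': "v' \<in> W" "v = h (pres_gen S R y) *\<^sub>v v'" using v by blast
    have "h (word_cong S R `` {[(y, False)]}) *\<^sub>v v = v'"
      using act[OF cl py, of v'] act_one[of v'] v' Wm inv by auto
    then show ?thesis using v'(1) False by simp
  qed
  obtain u where u: "u \<in> lists (S \<times> UNIV)" "c = word_cong S R `` {u}"
    using c by (rule carrier_presented_groupE)
  have "h (word_cong S R `` {u}) *\<^sub>v v \<in> W"
    using u(1)
  proof (induction u)
    case Nil
    then show ?case using act_one[of v] v Wm by (auto simp: presented_group_one)
  next
    case (Cons y u)
    obtain z b where y: "y = (z, b)" "z \<in> S" using Cons by (cases y) auto
    have yw: "[y] \<in> lists (S \<times> UNIV)" using y by auto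
    have "word_cong S R `` {y # u} = word_cong S R `` {[y]} \<otimes>\<^bsub>?H\<^esub> word_cong S R `` {u}"
      using presented_group_mult[OF yw, of u R] Cons by simp
    then have "h (word_cong S R `` {y # u}) *\<^sub>v v
        = h (word_cong S R `` {[y]}) *\<^sub>v (h (word_cong S R `` {u}) *\<^sub>v v)"
      using act[of "word_cong S R `` {[y]}" "word_cong S R `` {u}" v] v Wm Cons
        class_in_presented_group[OF yw] class_in_presented_group[of u]
      by auto
    then show ?case using letter[OF y(2), of _ b] y(1) Cons by simp
  qed
  then show ?thesis using u(2) by simp
qed

section \<open>The pair attached to a quiver representation\<close>

locale prp_quiver_rep =
  fixes g n r :: nat and s :: "nat \<Rightarrow> nat" and d :: "nat \<Rightarrow> nat \<Rightarrow> nat"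
    and x :: "qarr \<Rightarrow> complex mat"
  assumes x: "x \<in> REP_prp g n r s d"
    and d_pos: "\<And>i l. i \<in> {1..n} \<Longrightarrow> l \<in> {0..s i} \<Longrightarrow> d i l > 0"
    and d_sum: "\<And>i. i \<in> {1..n} \<Longrightarrow> (\<Sum>l=0..s i. d i l) = r"
begin

abbreviation Q where "Q \<equiv> prp_quiver g n s"
abbreviation D where "D i l \<equiv> dimQ r s d (vtx i l)"
abbreviation leg where "leg \<equiv> leg_map r s d x"
abbreviation F where "F \<equiv> image_flag r s d x"
abbreviation \<rho> where "\<rho> \<equiv> rho_of g n r x"

lemma D_eq: "i \<in> {1..n} \<Longrightarrow> D i l = (\<Sum>m=l..s i. d i m)"
  using d_sum by (simp add: vtx_def)

lemma arrow:
  assumes "a \<in> arcs Q"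
  shows "x a \<in> carrier_mat (dimQ r s d (qhead a)) (dimQ r s d (qtail a))"
    "inj_on (\<lambda>v. x a *\<^sub>v v) (carrier_vec (dimQ r s d (qtail a)))"
proof -
  have "x a \<in> carrier_mat (dimQ r s d (head Q a)) (dimQ r s d (tail Q a))"
    using x assms unfolding REP_prp_def REP_def by blast
  then show "x a \<in> carrier_mat (dimQ r s d (qhead a)) (dimQ r s d (qtail a))"
    by (simp add: prp_quiver_def)
  show "inj_on (\<lambda>v. x a *\<^sub>v v) (carrier_vec (dimQ r s d (qtail a)))"
    using x assms unfolding REP_prp_def by blast
qed

lemma arrow_C:
  assumes "i \<in> {1..n}" "l \<le> s i"
  shows "x (ArrC i l) \<in> carrier (GL (D i l))"
  using arrow[of "ArrC i l"] assms by (intro carrier_GL_if_inj) (auto simp: prp_quiver_def)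

lemma arrow_E:
  assumes "i \<in> {1..n}" "Suc l \<le> s i"
  shows "x (ArrE i (Suc l)) \<in> carrier_mat (D i l) (D i (Suc l))"
    "inj_on (\<lambda>v. x (ArrE i (Suc l)) *\<^sub>v v) (carrier_vec (D i (Suc l)))"
  using arrow[of "ArrE i (Suc l)"] assms by (auto simp: prp_quiver_def)

lemma leg_0: "leg i 0 = 1\<^sub>m r"
  by (simp add: leg_map_def vtx_def)

text \<open>The product that defines \<open>leg i l\<close> is folded from the right and ends in an identity matrix whose
size depends on \<open>l\<close>. With an arbitrary last factor \<open>B\<close> instead, the induction on \<open>l\<close> goes through
and yields the recursion \<open>leg i (l + 1) = leg i l * x\<^bsub>e (l + 1)\<^esub>\<close>.\<close>

lemma leg_foldr:
  assumes "i \<in> {1..n}" "l \<le> s i"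
  shows "leg i l \<in> carrier_mat r (D i l) \<and> (\<forall>k. \<forall>B \<in> carrier_mat (D i l) k.
    foldr (*) (map (\<lambda>m. x (ArrE i m)) [1..<Suc l]) B = leg i l * B)"
  using assms(2)
proof (induction l)
  case 0
  have "D i 0 = r" by (simp add: vtx_def)
  then show ?case by (simp add: leg_0)
next
  case (Suc l)
  let ?E = "x (ArrE i (Suc l))"
  have E: "?E \<in> carrier_mat (D i l) (D i (Suc l))" using arrow_E(1) assms(1) Suc.prems by simp
  have L: "leg i l \<in> carrier_mat r (D i l)" using Suc by simp
  have step: "foldr (*) (map (\<lambda>m. x (ArrE i m)) [1..<Suc (Suc l)]) B = leg i l * (?E * B)"
    if "B \<in> carrier_mat (D i (Suc l)) k" for k B
  proof -
    have "?E * B \<in> carrier_mat (D i l) k" using E that by simp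
    then show ?thesis using Suc by simp
  qed
  have leg: "leg i (Suc l) = leg i l * ?E"
    unfolding leg_map_def[of r s d x i "Suc l"] using step[OF one_carrier_mat] E by (simp del: upt_Suc)
  then show ?case
    using step L E assoc_mult_mat[OF L E] by auto
qed

lemma leg_carrier: "i \<in> {1..n} \<Longrightarrow> l \<le> s i \<Longrightarrow> leg i l \<in> carrier_mat r (D i l)"
  using leg_foldr by blast

lemma leg_Suc:
  assumes "i \<in> {1..n}" "Suc l \<le> s i"
  shows "leg i (Suc l) = leg i l * x (ArrE i (Suc l))"
  using leg_foldr[of i l] arrow_E(1)[OF assms] assms by (simp add: leg_map_def)

lemma leg_Suc_vec:
  assumes "i \<in> {1..n}" "Suc l \<le> s i" "y \<in> carrier_vec (D i (Suc l))"
  shows "leg i (Suc l) *\<^sub>v y = leg i l *\<^sub>v (x (ArrE i (Suc l)) *\<^sub>v y)"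
  unfolding leg_Suc[OF assms(1,2)]
  using assoc_mult_mat_vec[OF leg_carrier arrow_E(1)[OF assms(1,2)] assms(3)] assms by simp

lemma leg_inj:
  assumes "i \<in> {1..n}" "l \<le> s i"
  shows "inj_on (\<lambda>v. leg i l *\<^sub>v v) (carrier_vec (D i l))"
  using assms(2)
proof (induction l)
  case 0
  then show ?case by (auto simp: leg_0 vtx_def intro!: inj_onI)
next
  case (Suc l)
  note E = arrow_E[OF assms(1) Suc.prems]
  show ?case
  proof (rule inj_onI)
    fix y z assume y: "y \<in> carrier_vec (D i (Suc l))" and z: "z \<in> carrier_vec (D i (Suc l))"
      and eq: "leg i (Suc l) *\<^sub>v y = leg i (Suc l) *\<^sub>v z"
    have "x (ArrE i (Suc l)) *\<^sub>v y \<in> carrier_vec (D i l)" "x (ArrE i (Suc l)) *\<^sub>v z \<in> carrier_vec (D i l)"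
      using E(1) y z by simp_all
    then have "x (ArrE i (Suc l)) *\<^sub>v y = x (ArrE i (Suc l)) *\<^sub>v z"
      using eq leg_Suc_vec[OF assms(1) Suc.prems] y z Suc by (auto dest: inj_onD)
    then show "y = z" using inj_onD[OF E(2)] y z by blast
  qed
qed

text \<open>The commutation relations \<open>x\<^bsub>c (l - 1)\<^esub> x\<^bsub>e l\<^esub> = x\<^bsub>e l\<^esub> x\<^bsub>c l\<^esub>\<close> say that all squares along the leg
commute; composing them gives the outer rectangle.\<close>

lemma leg_intertwines:
  assumes "i \<in> {1..n}" "l \<le> s i"
  shows "x (ArrC i 0) * leg i l = leg i l * x (ArrC i l)"
  using assms(2)
proof (induction l)
  case 0
  have "x (ArrC i 0) \<in> carrier_mat r r"
    using GL_inj(1)[OF arrow_C[OF assms(1), of 0]] by (simp add: vtx_def)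
  then show ?case by (simp add: leg_0)
next
  case (Suc l)
  let ?E = "x (ArrE i (Suc l))"
  note E = arrow_E(1)[OF assms(1) Suc.prems]
  have C0: "x (ArrC i 0) \<in> carrier_mat r r"
    using GL_inj(1)[OF arrow_C[OF assms(1), of 0]] by (simp add: vtx_def)
  have C: "x (ArrC i l) \<in> carrier_mat (D i l) (D i l)"
    "x (ArrC i (Suc l)) \<in> carrier_mat (D i (Suc l)) (D i (Suc l))"
    using GL_inj(1) arrow_C[OF assms(1)] Suc.prems by simp_all
  have L: "leg i l \<in> carrier_mat r (D i l)" using leg_carrier assms(1) Suc.prems by simp
  have rel: "\<forall>i\<in>{1..n}. \<forall>l\<in>{1..s i}. x (ArrC i (l - 1)) * x (ArrE i l) = x (ArrE i l) * x (ArrC i l)"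
    using x unfolding REP_prp_def by blast
  have comm: "x (ArrC i l) * ?E = ?E * x (ArrC i (Suc l))"
    using rel[rule_format, OF assms(1), of "Suc l"] Suc.prems by simp
  have "x (ArrC i 0) * leg i (Suc l) = (x (ArrC i 0) * leg i l) * ?E"
    using leg_Suc[OF assms(1) Suc.prems] assoc_mult_mat[OF C0 L E] by simp
  also have "\<dots> = leg i l * (x (ArrC i l) * ?E)"
    using Suc assoc_mult_mat[OF L C(1) E] by simp
  also have "\<dots> = leg i (Suc l) * x (ArrC i (Suc l))"
    using leg_Suc[OF assms(1) Suc.prems] comm assoc_mult_mat[OF L E C(2)] by simp
  finally show ?case .
qed

lemma leg_intertwines_vec:
  assumes "i \<in> {1..n}" "l \<le> s i" "y \<in> carrier_vec (D i l)"
  shows "x (ArrC i 0) *\<^sub>v (leg i l *\<^sub>v y) = leg i l *\<^sub>v (x (ArrC i l) *\<^sub>v y)"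
proof -
  have C0: "x (ArrC i 0) \<in> carrier_mat r r"
    using GL_inj(1)[OF arrow_C[OF assms(1), of 0]] by (simp add: vtx_def)
  note L = leg_carrier[OF assms(1,2)]
  note C = GL_inj(1)[OF arrow_C[OF assms(1,2)]]
  show ?thesis
    using assoc_mult_mat_vec[OF C0 L assms(3)] assoc_mult_mat_vec[OF L C assms(3)]
      leg_intertwines[OF assms(1,2)] by simp
qed

lemma F_leg: "l \<le> s i \<Longrightarrow> F i l = (\<lambda>v. leg i l *\<^sub>v v) ` carrier_vec (D i l)"
  and F_last: "F i (Suc (s i)) = {0\<^sub>v r}"
  by (auto simp: image_flag_def)

lemma F_subspace:
  assumes "i \<in> {1..n}" "l \<le> Suc (s i)"
  shows "lin_subspace r (F i l)"
proof (cases "l \<le> s i")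
  case True
  then show ?thesis
    unfolding F_leg[OF True]
    by (intro lin_subspace_image[OF leg_carrier[OF assms(1) True]] lin_subspace_carrier)
next
  case False
  then have "l = Suc (s i)" using assms by simp
  then show ?thesis using lin_subspace_zero by (simp add: F_last)
qed

lemma sdim_F:
  assumes "i \<in> {1..n}" "l \<le> Suc (s i)"
  shows "sdim r (F i l) = (\<Sum>m=l..s i. d i m)"
proof (cases "l \<le> s i")
  case True
  then show ?thesis
    unfolding F_leg[OF True]
    using sdim_image[OF leg_carrier lin_subspace_carrier leg_inj] assms sdim_carrier D_eq by simp
next
  case False
  then have "l = Suc (s i)" using assms by simp
  then show ?thesis using sdim_zero by (simp add: F_last)
qed

text \<open>The maps along a leg are injective, so the \<open>l\<close>-th image has dimension \<open>D i l\<close>, and consecutive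
values of \<open>D i\<close> differ by \<open>d i l > 0\<close>.\<close>

lemma is_flag_F:
  assumes i: "i \<in> {1..n}"
  shows "is_flag r (s i) (d i) (F i)"
proof -
  have "F i (Suc l) \<subset> F i l \<and> quot_dim r (F i l) (F i (Suc l)) = d i l" if l: "l \<le> s i" for l
  proof -
    have "(\<Sum>m=l..s i. d i m) = d i l + (\<Sum>m=Suc l..s i. d i m)"
      using l by (rule sum.atLeast_Suc_atMost)
    then have dims: "sdim r (F i l) = d i l + sdim r (F i (Suc l))"
      using sdim_F[OF i] l by simp
    have "F i (Suc l) \<subseteq> F i l"
    proof (cases "Suc l \<le> s i")
      case True
      have "leg i (Suc l) *\<^sub>v y \<in> F i l" if y: "y \<in> carrier_vec (D i (Suc l))" for y
        using leg_Suc_vec[OF i True y] arrow_E(1)[OF i True] y F_leg[OF l] by auto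
      then show ?thesis by (auto simp: F_leg[OF True])
    next
      case False
      then have "Suc l = Suc (s i)" using l by simp
      then show ?thesis using F_last[of i] lin_subspaceD(2)[OF F_subspace[OF i, of l]] l by simp
    qed
    moreover have "F i (Suc l) \<noteq> F i l" using dims d_pos[OF i, of l] l by auto
    ultimately show ?thesis using dims by (auto simp: quot_dim_def)
  qed
  moreover have "F i 0 = carrier_vec r" by (simp add: F_leg leg_0 vtx_def)
  moreover have "F i \<in> extensional {0..Suc (s i)}" by (simp add: image_flag_def)
  ultimately show ?thesis
    using F_subspace[OF i] F_last[of i] by (auto simp: is_flag_def)
qed

lemma rho:
  "\<rho> \<in> hom (surf_group g n) (GL r)" "\<rho> \<in> extensional (carrier (surf_group g n))"
  "\<And>j. j \<in> {1..g} \<Longrightarrow> \<rho> (surf_elt g n (Alpha j)) = x (ArrA j)"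
  "\<And>j. j \<in> {1..g} \<Longrightarrow> \<rho> (surf_elt g n (Beta j)) = x (ArrB j)"
  "\<And>i. i \<in> {1..n} \<Longrightarrow> \<rho> (surf_elt g n (Gamma i)) = x (ArrC i 0)"
  using theI'[OF ex1_rho_of[OF x]] unfolding rho_of_def[symmetric] by blast+

lemma phi_in_PRP: "phi g n r s d x \<in> PRP g n r s d"
proof -
  have stab: "x (ArrC i 0) \<in> flag_stabilizer r (s i) (F i)" if i: "i \<in> {1..n}" for i
  proof -
    have C0: "x (ArrC i 0) \<in> carrier (GL r)" using arrow_C[OF i, of 0] by (simp add: vtx_def)
    have "x (ArrC i 0) *\<^sub>v v \<in> F i l" if l: "l \<le> Suc (s i)" and v: "v \<in> F i l" for l v
    proof (cases "l \<le> s i")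
      case True
      then obtain y where y: "y \<in> carrier_vec (D i l)" "v = leg i l *\<^sub>v y" using v F_leg by auto
      have "x (ArrC i l) *\<^sub>v y \<in> carrier_vec (D i l)"
        using GL_inj(1)[OF arrow_C[OF i True]] y(1) by simp
      then show ?thesis using leg_intertwines_vec[OF i True y(1)] y(2) F_leg[OF True] by auto
    next
      case False
      then have "l = Suc (s i)" using l by simp
      moreover have "x (ArrC i 0) *\<^sub>v 0\<^sub>v r = 0\<^sub>v r"
        using GL_inj(1)[OF C0] by (intro eq_vecI) auto
      ultimately show ?thesis using v by (simp add: F_last)
    qed
    then show ?thesis
      using C0 GL_invariant_eq[OF C0 F_subspace[OF i]] by (simp add: flag_stabilizer_def)
  qed
  have "(\<exists>F'. is_flag r (s i) (d i) F' \<and> flag_stabilizer r (s i) (F i) = flag_stabilizer r (s i) F') \<and>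
      \<rho> (surf_elt g n (Gamma i)) \<in> flag_stabilizer r (s i) (F i)" if i: "i \<in> {1..n}" for i
    using is_flag_F[OF i] stab[OF i] rho(5)[OF i] by auto
  then show ?thesis
    using rho(1,2) by (simp add: PRP_def phi_def)
qed

lemma is_subrep_iff:
  "is_subrep g n r \<rho> W \<longleftrightarrow> lin_subspace r W \<and>
    (\<forall>v\<in>W. (\<forall>j\<in>{1..g}. x (ArrA j) *\<^sub>v v \<in> W \<and> x (ArrB j) *\<^sub>v v \<in> W) \<and>
      (\<forall>i\<in>{1..n}. x (ArrC i 0) *\<^sub>v v \<in> W))"
  (is "?L \<longleftrightarrow> ?R")
proof
  assume L: ?L
  have "surf_elt g n y \<in> carrier (surf_group g n)" if "y \<in> surf_gens g n" for y
    unfolding surf_elt_def surf_group_def by (rule pres_gen_closed[OF that])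
  then have inv: "\<rho> (surf_elt g n y) *\<^sub>v v \<in> W" if "y \<in> surf_gens g n" "v \<in> W" for y v
    using that L unfolding is_subrep_def by blast
  have "x (ArrA j) *\<^sub>v v \<in> W" "x (ArrB j) *\<^sub>v v \<in> W" if "j \<in> {1..g}" "v \<in> W" for j v
    using inv[of "Alpha j" v] inv[of "Beta j" v] rho(3,4)[OF that(1)] that
    by (simp_all add: surf_gens_def)
  moreover have "x (ArrC i 0) *\<^sub>v v \<in> W" if "i \<in> {1..n}" "v \<in> W" for i v
    using inv[of "Gamma i" v] rho(5)[OF that(1)] that by (simp add: surf_gens_def)
  ultimately show ?R using L by (simp add: is_subrep_def)
next
  assume R: ?R
  have gen: "\<rho> (pres_gen (surf_gens g n) {surf_relator g n} y) *\<^sub>v v \<in> W"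
    if "y \<in> surf_gens g n" "v \<in> W" for y v
  proof -
    consider j where "y = Alpha j" "j \<in> {1..g}" | j where "y = Beta j" "j \<in> {1..g}"
      | i where "y = Gamma i" "i \<in> {1..n}"
      using \<open>y \<in> surf_gens g n\<close> unfolding surf_gens_def by blast
    then show ?thesis
      using R \<open>v \<in> W\<close> rho(3-5) unfolding surf_elt_def[symmetric] by cases simp_all
  qed
  show ?L
    unfolding is_subrep_def surf_group_def
    using presented_group_hom_invariant[OF rho(1)[unfolded surf_group_def] _ gen] R by blast
qed

end

section \<open>Comparison of degrees\<close>

lemma sum_by_parts:
  fixes w a :: "nat \<Rightarrow> real"
  shows "(\<Sum>l=0..k. w l * (a l - a (Suc l))) =
    w 0 * a 0 + (\<Sum>l=1..k. (w l - w (l - 1)) * a l) - w k * a (Suc k)"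
  by (induction k) (simp_all add: algebra_simps)

context prp_quiver_rep
begin

text \<open>Summation by parts turns the degree into a combination of the dimensions of \<open>F i l \<inter> W\<close> whose
coefficients for \<open>l \<ge> 1\<close> are the quiver weights \<open>w i l - w i (l - 1)\<close>. The flag enters the degree
through its stabilizer, from which \<open>flag_of_stabilizer\<close> recovers it.\<close>

lemma sub_deg_eq:
  assumes W: "lin_subspace r W"
  shows "sub_deg n r s d w (snd (phi g n r s d x)) W = (\<Sum>i=1..n. w i 0 * real (sdim r W) +
    (\<Sum>l=1..s i. (w i l - w i (l - 1)) * real (sdim r (F i l \<inter> W))))"
  unfolding sub_deg_def
proof (rule sum.cong[OF HOL.refl])
  fix i assume i: "i \<in> {1..n}"
  define a where "a = (\<lambda>l. real (sdim r (F i l \<inter> W)))"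
  have sub: "lin_subspace r (F i l \<inter> W)" if "l \<le> Suc (s i)" for l
    using lin_subspace_Int[OF F_subspace[OF i that] W] .
  have flag: "flag_of r (s i) (d i) (snd (phi g n r s d x) i) = F i"
    using i flag_of_stabilizer[OF is_flag_F[OF i]] by (simp add: phi_def)
  have q: "real (quot_dim r (F i l \<inter> W) (F i (Suc l) \<inter> W)) = a l - a (Suc l)" if "l \<le> s i" for l
  proof -
    have "F i (Suc l) \<inter> W \<subseteq> F i l \<inter> W"
      using flag_antimono[OF is_flag_F[OF i], of l "Suc l"] that by auto
    then show ?thesis
      using sdim_mono[OF sub sub] that by (simp add: quot_dim_def a_def of_nat_diff)
  qed
  have "F i 0 \<inter> W = W" using is_flag_F[OF i] lin_subspaceD(1)[OF W] by (auto simp: is_flag_def)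
  then have a0: "a 0 = real (sdim r W)" by (simp add: a_def)
  have "F i (Suc (s i)) \<inter> W = {0\<^sub>v r}" using lin_subspaceD(2)[OF W] by (auto simp: F_last)
  then have aS: "a (Suc (s i)) = 0" by (simp add: a_def sdim_zero)
  have "(\<Sum>l=0..s i. w i l * real (quot_dim r (F i l \<inter> W) (F i (Suc l) \<inter> W))) =
      (\<Sum>l=0..s i. w i l * (a l - a (Suc l)))"
    using q by (intro sum.cong) auto
  then show "(let F = flag_of r (s i) (d i) (snd (phi g n r s d x) i) in
      \<Sum>l=0..s i. w i l * real (quot_dim r (F l \<inter> W) (F (Suc l) \<inter> W))) =
    w i 0 * real (sdim r W) + (\<Sum>l=1..s i. (w i l - w i (l - 1)) * real (sdim r (F i l \<inter> W)))"
    unfolding Let_def flag using sum_by_parts[of "w i" a "s i"] a0 aS by (simp add: a_def)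
qed

lemma sum_verts:
  fixes f :: "qvert \<Rightarrow> real"
  shows "(\<Sum>v\<in>verts Q. f v) = f Hub + (\<Sum>i=1..n. \<Sum>l=1..s i. f (Leg i l))"
proof -
  have V: "{Leg i l | i l. i \<in> {1..n} \<and> l \<in> {1..s i}} = (\<lambda>(i, l). Leg i l) ` (SIGMA i:{1..n}. {1..s i})"
    by auto
  let ?L = "(\<lambda>(i, l). Leg i l) ` (SIGMA i:{1..n}. {1..s i})"
  have "verts Q = insert Hub ?L"
    unfolding prp_quiver_def V by simp
  moreover have "sum f ?L = (\<Sum>i=1..n. \<Sum>l=1..s i. f (Leg i l))"
    by (subst sum.reindex) (auto simp: inj_on_def sum.Sigma case_prod_unfold)
  moreover have "sum f (insert Hub ?L) = f Hub + sum f ?L"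
    by (rule sum.insert) auto
  ultimately show ?thesis by simp
qed

text \<open>The key identity. The last sum measures how far the subspaces on the legs are from the largest ones
compatible with the subspace at the hub.\<close>

lemma quiver_deg_eq:
  assumes H: "lin_subspace r (W Hub)"
  shows "(\<Sum>v\<in>verts Q. weightQ n r s d w v * real (sdim (dimQ r s d v) (W v))) =
    sub_deg n r s d w (snd (phi g n r s d x)) (W Hub) - pair_slope n r s d w * real (sdim r (W Hub))
    - (\<Sum>i=1..n. \<Sum>l=1..s i. (w i l - w i (l - 1)) *
        (real (sdim r (F i l \<inter> W Hub)) - real (sdim (D i l) (W (Leg i l)))))"
proof -
  let ?k = "real (sdim r (W Hub))"
  have hub: "weightQ n r s d w Hub = - pair_slope n r s d w + (\<Sum>i=1..n. w i 0)"
    by (simp add: pair_slope_def pair_deg_def mult.commute)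
  have legs: "(\<Sum>i=1..n. \<Sum>l=1..s i. weightQ n r s d w (Leg i l) *
        real (sdim (dimQ r s d (Leg i l)) (W (Leg i l)))) =
      (\<Sum>i=1..n. \<Sum>l=1..s i. (w i l - w i (l - 1)) * real (sdim (D i l) (W (Leg i l))))"
    by (intro sum.cong HOL.refl) (simp add: vtx_def)
  have "(\<Sum>v\<in>verts Q. weightQ n r s d w v * real (sdim (dimQ r s d v) (W v))) =
      (- pair_slope n r s d w + (\<Sum>i=1..n. w i 0)) * ?k +
      (\<Sum>i=1..n. \<Sum>l=1..s i. (w i l - w i (l - 1)) * real (sdim (D i l) (W (Leg i l))))"
    unfolding sum_verts legs hub by simp
  then show ?thesis
    unfolding sub_deg_eq[OF H]
    by (simp add: sum.distrib sum_subtractf right_diff_distrib sum_distrib_left[symmetric]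
        sum_distrib_right[symmetric] distrib_right left_diff_distrib del: One_nat_def)
qed

lemma subrep_subspace:
  assumes "is_quiver_subrep Q (dimQ r s d) x W"
  shows "lin_subspace r (W Hub)"
    "i \<in> {1..n} \<Longrightarrow> l \<le> s i \<Longrightarrow> lin_subspace (D i l) (W (vtx i l))"
proof -
  have sub: "lin_subspace (dimQ r s d v) (W v)" if "v \<in> verts Q" for v
    using assms that unfolding is_quiver_subrep_def by blast
  show "lin_subspace r (W Hub)" using sub[of Hub] by (simp add: prp_quiver_def)
  show "lin_subspace (D i l) (W (vtx i l))" if "i \<in> {1..n}" "l \<le> s i"
    using that by (intro sub) (auto simp: prp_quiver_def vtx_def)
qed

section \<open>Subrepresentations of the pair and of the quiver\<close>

lemma subrep_leg_image:
  assumes W: "is_quiver_subrep Q (dimQ r s d) x W" and i: "i \<in> {1..n}" and l: "l \<le> s i"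
    and y: "y \<in> W (vtx i l)"
  shows "leg i l *\<^sub>v y \<in> W Hub"
  using l y
proof (induction l arbitrary: y)
  case 0
  have "W Hub \<subseteq> carrier_vec r"
    by (rule lin_subspaceD(1)[OF subrep_subspace(1)[OF W]])
  then have "y \<in> carrier_vec r" using 0 by (auto simp: vtx_def)
  then show ?case using 0 by (simp add: leg_0 vtx_def)
next
  case (Suc l)
  have "lin_subspace (D i (Suc l)) (W (vtx i (Suc l)))"
    by (rule subrep_subspace(2)[OF W i Suc.prems(1)])
  then have y: "y \<in> carrier_vec (D i (Suc l))" using lin_subspaceD(1) Suc.prems by blast
  have "ArrE i (Suc l) \<in> arcs Q" using i Suc.prems by (simp add: prp_quiver_def)
  then have "\<forall>y\<in>W (tail Q (ArrE i (Suc l))). x (ArrE i (Suc l)) *\<^sub>v y \<in> W (head Q (ArrE i (Suc l)))"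
    using W unfolding is_quiver_subrep_def by blast
  then have "x (ArrE i (Suc l)) *\<^sub>v y \<in> W (vtx i l)"
    using Suc.prems by (simp add: prp_quiver_def)
  then show ?case using Suc leg_Suc_vec[OF i _ y] by simp
qed

lemma subrep_leg_dim_le:
  assumes W: "is_quiver_subrep Q (dimQ r s d) x W" and i: "i \<in> {1..n}" and l: "l \<in> {1..s i}"
  shows "sdim (D i l) (W (Leg i l)) \<le> sdim r (F i l \<inter> W Hub)"
proof -
  have l': "l \<le> s i" "vtx i l = Leg i l" using l by (auto simp: vtx_def)
  have sub: "lin_subspace (D i l) (W (Leg i l))" "lin_subspace r (W Hub)"
    using subrep_subspace(2)[OF W i l'(1)] subrep_subspace(1)[OF W] by (simp_all only: l'(2))
  have carr: "W (Leg i l) \<subseteq> carrier_vec (D i l)" by (rule lin_subspaceD(1)[OF sub(1)])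
  note L = leg_carrier[OF i l'(1)]
  have "sdim (D i l) (W (Leg i l)) = sdim r ((\<lambda>v. leg i l *\<^sub>v v) ` W (Leg i l))"
    using sdim_image[OF L sub(1) inj_on_subset[OF leg_inj[OF i l'(1)] carr]] by simp
  also have "\<dots> \<le> sdim r (F i l \<inter> W Hub)"
  proof (rule sdim_mono)
    show "lin_subspace r ((\<lambda>v. leg i l *\<^sub>v v) ` W (Leg i l))" by (rule lin_subspace_image[OF L sub(1)])
    show "lin_subspace r (F i l \<inter> W Hub)"
      using lin_subspace_Int[OF F_subspace[OF i] sub(2)] l'(1) by simp
    show "(\<lambda>v. leg i l *\<^sub>v v) ` W (Leg i l) \<subseteq> F i l \<inter> W Hub"
      using subrep_leg_image[OF W i l'(1)] carr l'(2) by (auto simp: F_leg[OF l'(1)])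
  qed
  finally show ?thesis .
qed

lemma subrep_hub:
  assumes W: "is_quiver_subrep Q (dimQ r s d) x W"
  shows "is_subrep g n r \<rho> (W Hub)"
proof -
  have inv: "x a *\<^sub>v v \<in> W (qhead a)" if "a \<in> arcs Q" "v \<in> W (qtail a)" for a v
  proof -
    have "\<forall>y\<in>W (tail Q a). x a *\<^sub>v y \<in> W (head Q a)"
      using W that(1) unfolding is_quiver_subrep_def by blast
    then show ?thesis using that(2) by (simp add: prp_quiver_def)
  qed
  have "x (ArrA j) *\<^sub>v v \<in> W Hub" "x (ArrB j) *\<^sub>v v \<in> W Hub"
    if "j \<in> {1..g}" "v \<in> W Hub" for j v
    using inv[of "ArrA j" v] inv[of "ArrB j" v] that by (simp_all add: prp_quiver_def)
  moreover have "x (ArrC i 0) *\<^sub>v v \<in> W Hub" if "i \<in> {1..n}" "v \<in> W Hub" for i v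
    using inv[of "ArrC i 0" v] that by (simp add: prp_quiver_def vtx_def)
  ultimately show ?thesis
    unfolding is_subrep_iff using subrep_subspace(1)[OF W] by simp
qed

text \<open>For a subspace \<open>U\<close> stable under \<open>\<rho>\<close>, this is the largest quiver subrepresentation that has
\<open>U\<close> at the hub.\<close>

definition saturation :: "complex vec set \<Rightarrow> qvert \<Rightarrow> complex vec set" where
  "saturation U = (\<lambda>v. case v of Hub \<Rightarrow> U
    | Leg i l \<Rightarrow> {y \<in> carrier_vec (D i l). leg i l *\<^sub>v y \<in> U})"

lemma saturation_vtx:
  assumes "U \<subseteq> carrier_vec r"
  shows "saturation U (vtx i l) = {y \<in> carrier_vec (D i l). leg i l *\<^sub>v y \<in> U}"
  using assms by (auto simp: saturation_def vtx_def leg_0)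

lemma saturation_subrep:
  assumes U: "is_subrep g n r \<rho> U"
  shows "is_quiver_subrep Q (dimQ r s d) x (saturation U)"
proof -
  have U': "lin_subspace r U"
    "\<And>j v. j \<in> {1..g} \<Longrightarrow> v \<in> U \<Longrightarrow> x (ArrA j) *\<^sub>v v \<in> U"
    "\<And>j v. j \<in> {1..g} \<Longrightarrow> v \<in> U \<Longrightarrow> x (ArrB j) *\<^sub>v v \<in> U"
    "\<And>i v. i \<in> {1..n} \<Longrightarrow> v \<in> U \<Longrightarrow> x (ArrC i 0) *\<^sub>v v \<in> U"
    using U unfolding is_subrep_iff by blast+
  note sat = saturation_vtx[OF lin_subspaceD(1)[OF U'(1)]]
  have hub: "saturation U Hub = U" by (simp add: saturation_def)
  have "lin_subspace (dimQ r s d v) (saturation U v)" if v: "v \<in> verts Q" for v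
  proof (cases v)
    case Hub
    then show ?thesis using U' hub by simp
  next
    case (Leg i l)
    then have il: "i \<in> {1..n}" "l \<le> s i" "v = vtx i l" using v by (auto simp: prp_quiver_def vtx_def)
    show ?thesis
      unfolding il(3) sat by (rule lin_subspace_vimage[OF leg_carrier[OF il(1,2)] U'(1)])
  qed
  moreover have "x a *\<^sub>v y \<in> saturation U (qhead a)" if a: "a \<in> arcs Q" and y: "y \<in> saturation U (qtail a)" for a y
  proof (cases a)
    case (ArrA j)
    then show ?thesis using U'(2)[of j y] a y hub by (auto simp: prp_quiver_def)
  next
    case (ArrB j)
    then show ?thesis using U'(3)[of j y] a y hub by (auto simp: prp_quiver_def)
  next
    case (ArrC i l)
    then have il: "i \<in> {1..n}" "l \<le> s i" using a by (auto simp: prp_quiver_def)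
    have y': "y \<in> carrier_vec (D i l)" "leg i l *\<^sub>v y \<in> U" using y ArrC by (auto simp: sat)
    have "leg i l *\<^sub>v (x (ArrC i l) *\<^sub>v y) \<in> U"
      using leg_intertwines_vec[OF il y'(1)] U'(4)[OF il(1) y'(2)] by simp
    moreover have "x (ArrC i l) *\<^sub>v y \<in> carrier_vec (D i l)"
      using GL_inj(1)[OF arrow_C[OF il]] y'(1) by simp
    ultimately show ?thesis by (simp add: ArrC sat)
  next
    case (ArrE i k)
    then obtain l where k: "k = Suc l" and il: "i \<in> {1..n}" "Suc l \<le> s i"
      using a by (cases k) (auto simp: prp_quiver_def)
    have y': "y \<in> carrier_vec (D i (Suc l))" "leg i (Suc l) *\<^sub>v y \<in> U" using y ArrE k by (auto simp: sat)
    have "leg i l *\<^sub>v (x (ArrE i (Suc l)) *\<^sub>v y) \<in> U" using leg_Suc_vec[OF il y'(1)] y'(2) by simp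
    moreover have "x (ArrE i (Suc l)) *\<^sub>v y \<in> carrier_vec (D i l)" using arrow_E(1)[OF il] y'(1) by simp
    ultimately show ?thesis by (simp add: ArrE k sat)
  qed
  ultimately show ?thesis by (simp add: is_quiver_subrep_def prp_quiver_def)
qed

lemma sdim_saturation:
  assumes U: "lin_subspace r U" and i: "i \<in> {1..n}" and l: "l \<in> {1..s i}"
  shows "sdim (D i l) (saturation U (Leg i l)) = sdim r (F i l \<inter> U)"
proof -
  have l': "l \<le> s i" "vtx i l = Leg i l" using l by (auto simp: vtx_def)
  note L = leg_carrier[OF i l'(1)]
  have sat: "saturation U (Leg i l) = {y \<in> carrier_vec (D i l). leg i l *\<^sub>v y \<in> U}"
    by (simp add: saturation_def)
  have "F i l \<inter> U = (\<lambda>v. leg i l *\<^sub>v v) ` saturation U (Leg i l)"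
    unfolding F_leg[OF l'(1)] sat by auto
  moreover have "inj_on (\<lambda>v. leg i l *\<^sub>v v) (saturation U (Leg i l))"
    by (rule inj_on_subset[OF leg_inj[OF i l'(1)]]) (auto simp: sat)
  ultimately show ?thesis
    using sdim_image[OF L lin_subspace_vimage[OF L U]] unfolding sat by simp
qed

lemma r_pos:
  assumes "n \<ge> 1"
  shows "r > 0"
proof -
  have "d 1 0 \<le> (\<Sum>l=0..s 1. d 1 l)" by (rule member_le_sum) auto
  then show ?thesis using d_pos[of 1 0] d_sum[of 1] assms by simp
qed

lemma sub_deg_zero: "sub_deg n r s d w (snd (phi g n r s d x)) {0\<^sub>v r} = 0"
proof -
  have "F i l \<inter> {0\<^sub>v r} = {0\<^sub>v r}" if "i \<in> {1..n}" "l \<in> {1..s i}" for i l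
    using lin_subspaceD(2)[OF F_subspace[of i l]] that by auto
  then show ?thesis
    unfolding sub_deg_eq[OF lin_subspace_zero] by (simp add: sdim_zero)
qed

lemma sub_deg_carrier: "sub_deg n r s d w (snd (phi g n r s d x)) (carrier_vec r) = pair_deg n s d w"
  unfolding sub_deg_def pair_deg_def Let_def
proof (intro sum.cong HOL.refl)
  fix i l assume i: "i \<in> {1..n}" and l: "l \<in> {0..s i}"
  have flag: "flag_of r (s i) (d i) (snd (phi g n r s d x) i) = F i"
    using i flag_of_stabilizer[OF is_flag_F[OF i]] by (simp add: phi_def)
  have "F i m \<inter> carrier_vec r = F i m" if "m \<le> Suc (s i)" for m
    using lin_subspaceD(1)[OF F_subspace[OF i that]] by blast
  then show "w i l * real (quot_dim r (flag_of r (s i) (d i) (snd (phi g n r s d x) i) l \<inter> carrier_vec r)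
      (flag_of r (s i) (d i) (snd (phi g n r s d x) i) (Suc l) \<inter> carrier_vec r)) = real (d i l) * w i l"
    using is_flag_F[OF i] l by (simp add: flag is_flag_def)
qed

section \<open>Semistability\<close>

text \<open>In \<open>quiver_deg_eq\<close> the last sum is nonnegative for every quiver subrepresentation, as the weights
increase and the subspaces on the legs inject into the flags, and it is \<open>0\<close> for a saturation.\<close>

lemma semistable_iff:
  assumes n: "n \<ge> 1" and w: "\<And>i. i \<in> {1..n} \<Longrightarrow> strict_mono_on {0..s i} (w i)"
  shows "pair_semistable g n r s d w (phi g n r s d x) \<longleftrightarrow>
    quiver_semistable Q (dimQ r s d) (weightQ n r s d w) x"
proof -
  let ?P = "snd (phi g n r s d x)"
  let ?deg = "sub_deg n r s d w ?P"
  let ?mu = "pair_slope n r s d w"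
  have phi: "phi g n r s d x = (\<rho>, ?P)" by (simp add: phi_def)
  have slope: "sub_slope n r s d w ?P U \<le> ?mu \<longleftrightarrow> ?deg U \<le> ?mu * real (sdim r U)"
    if U: "lin_subspace r U" "U \<noteq> {0\<^sub>v r}" for U
  proof -
    have "sdim r U \<noteq> 0"
      using sdim_eq_imp_eq[OF lin_subspace_zero U(1)] lin_subspaceD(2)[OF U(1)] U(2) by auto
    then show ?thesis by (simp add: sub_slope_def divide_le_eq)
  qed
  have pair: "pair_semistable g n r s d w (phi g n r s d x) \<longleftrightarrow>
      (\<forall>U. is_subrep g n r \<rho> U \<and> U \<noteq> {0\<^sub>v r} \<and> U \<noteq> carrier_vec r \<longrightarrow>
        ?deg U \<le> ?mu * real (sdim r U))"
  proof -
    have "(is_subrep g n r \<rho> U \<and> U \<noteq> {0\<^sub>v r} \<and> U \<noteq> carrier_vec r \<longrightarrow>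
          sub_slope n r s d w ?P U \<le> ?mu) \<longleftrightarrow>
        (is_subrep g n r \<rho> U \<and> U \<noteq> {0\<^sub>v r} \<and> U \<noteq> carrier_vec r \<longrightarrow>
          ?deg U \<le> ?mu * real (sdim r U))" for U
      using slope[of U] unfolding is_subrep_def by blast
    then show ?thesis by (subst phi) (simp only: pair_semistable_def prod.case)
  qed
  show ?thesis
  proof
    assume ss: "pair_semistable g n r s d w (phi g n r s d x)"
    show "quiver_semistable Q (dimQ r s d) (weightQ n r s d w) x"
      unfolding quiver_semistable_def
    proof (intro allI impI, elim conjE)
      fix W assume W: "is_quiver_subrep Q (dimQ r s d) x W"
      let ?U = "W Hub"
      have U: "is_subrep g n r \<rho> ?U" by (rule subrep_hub[OF W])
      then have Us: "lin_subspace r ?U" by (simp add: is_subrep_def)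
      have "?deg ?U \<le> ?mu * real (sdim r ?U)"
      proof (cases "?U = {0\<^sub>v r} \<or> ?U = carrier_vec r")
        \<comment> \<open>A proper quiver subrepresentation can be \<open>0\<close> or everything at the hub, where the
          semistability of the pair says nothing; there equality holds.\<close>
        case True
        then show ?thesis
          using sub_deg_zero sub_deg_carrier r_pos[OF n]
          by (auto simp: sdim_zero sdim_carrier pair_slope_def)
      next
        case False
        then show ?thesis using ss U unfolding pair by blast
      qed
      moreover have "0 \<le> (\<Sum>i=1..n. \<Sum>l=1..s i. (w i l - w i (l - 1)) *
        (real (sdim r (F i l \<inter> ?U)) - real (sdim (D i l) (W (Leg i l)))))"
      proof (intro sum_nonneg mult_nonneg_nonneg)
        fix i l assume i: "i \<in> {1..n}" and l: "l \<in> {1..s i}"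
        have "w i (l - 1) < w i l"
          by (rule strict_mono_onD[OF w[OF i]]) (use l in auto)
        then show "0 \<le> w i l - w i (l - 1)" by simp
        show "0 \<le> real (sdim r (F i l \<inter> ?U)) - real (sdim (D i l) (W (Leg i l)))"
          using subrep_leg_dim_le[OF W i l] by simp
      qed
      ultimately show "(\<Sum>v\<in>verts Q. weightQ n r s d w v * real (sdim (dimQ r s d v) (W v))) \<le> 0"
        using quiver_deg_eq[of W w] Us by linarith
    qed
  next
    assume ss: "quiver_semistable Q (dimQ r s d) (weightQ n r s d w) x"
    show "pair_semistable g n r s d w (phi g n r s d x)"
      unfolding pair
    proof (intro allI impI, elim conjE)
      fix U assume U: "is_subrep g n r \<rho> U" and ne: "U \<noteq> carrier_vec r"
      then have Us: "lin_subspace r U" by (simp add: is_subrep_def)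
      let ?W = "saturation U"
      have hub: "?W Hub = U" by (simp add: saturation_def)
      have "\<exists>v\<in>verts Q. ?W v \<noteq> carrier_vec (dimQ r s d v)"
        using ne hub by (intro bexI[of _ Hub]) (auto simp: prp_quiver_def)
      then have "(\<Sum>v\<in>verts Q. weightQ n r s d w v * real (sdim (dimQ r s d v) (?W v))) \<le> 0"
        using ss saturation_subrep[OF U] unfolding quiver_semistable_def by blast
      moreover have "(\<Sum>i=1..n. \<Sum>l=1..s i. (w i l - w i (l - 1)) *
        (real (sdim r (F i l \<inter> U)) - real (sdim (D i l) (?W (Leg i l))))) = 0"
        using sdim_saturation[OF Us] by (intro sum.neutral ballI) simp
      ultimately show "?deg U \<le> ?mu * real (sdim r U)"
        using quiver_deg_eq[of ?W w] Us unfolding hub by linarith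
    qed
  qed
qed

end

theorem proposition5p6:
  fixes g n r :: nat
    and s :: "nat \<Rightarrow> nat"
    and d :: "nat \<Rightarrow> nat \<Rightarrow> nat"
    and w :: "nat \<Rightarrow> nat \<Rightarrow> real"
  assumes "n \<ge> 1"
    and "2 - 2 * int g - int n < 0"
    and "\<And>i l. i \<in> {1..n} \<Longrightarrow> l \<in> {0..s i} \<Longrightarrow> d i l > 0"
    and "\<And>i. i \<in> {1..n} \<Longrightarrow> (\<Sum>l=0..s i. d i l) = r"
    and "\<And>i l. i \<in> {1..n} \<Longrightarrow> l \<in> {0..s i} \<Longrightarrow> w i l \<in> \<rat>"
    and "\<And>i. i \<in> {1..n} \<Longrightarrow> strict_mono_on {0..s i} (w i)"
  shows "(\<forall>\<rho> P x. (\<rho>, P) \<in> PRP g n r s d \<longrightarrow> x \<in> phi_preimage g n r s d {(\<rho>, P)} \<longrightarrow>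
      (pair_semistable g n r s d w (\<rho>, P) \<longleftrightarrow>
       quiver_semistable (prp_quiver g n s) (dimQ r s d) (weightQ n r s d w) x))
    \<and> phi_preimage g n r s d (PRP_ss g n r s d w) =
      REP_prp g n r s d \<inter> REP_ss (prp_quiver g n s) (dimQ r s d) (weightQ n r s d w)"
proof -
  have rep: "prp_quiver_rep g n r s d x" if "x \<in> REP_prp g n r s d" for x
    using that assms(3,4) by (intro prp_quiver_rep.intro) auto
  have iff: "pair_semistable g n r s d w (phi g n r s d x) \<longleftrightarrow>
      quiver_semistable (prp_quiver g n s) (dimQ r s d) (weightQ n r s d w) x"
    if "x \<in> REP_prp g n r s d" for x
    by (rule prp_quiver_rep.semistable_iff[OF rep[OF that] assms(1,6)])
  have PRP: "phi g n r s d x \<in> PRP g n r s d" if "x \<in> REP_prp g n r s d" for x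
    by (rule prp_quiver_rep.phi_in_PRP[OF rep[OF that]])
  have REP: "x \<in> REP (prp_quiver g n s) (dimQ r s d)" if "x \<in> REP_prp g n r s d" for x
    using that unfolding REP_prp_def by blast
  show ?thesis
  proof (intro conjI allI impI)
    fix \<rho> P x assume "x \<in> phi_preimage g n r s d {(\<rho>, P)}"
    then have "x \<in> REP_prp g n r s d" "phi g n r s d x = (\<rho>, P)" by (auto simp: phi_preimage_def)
    then show "pair_semistable g n r s d w (\<rho>, P) \<longleftrightarrow>
        quiver_semistable (prp_quiver g n s) (dimQ r s d) (weightQ n r s d w) x"
      using iff[of x] by simp
  next
    show "phi_preimage g n r s d (PRP_ss g n r s d w) =
        REP_prp g n r s d \<inter> REP_ss (prp_quiver g n s) (dimQ r s d) (weightQ n r s d w)"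
      using iff PRP REP unfolding phi_preimage_def PRP_ss_def REP_ss_def by blast
  qed
qed

end
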